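(* Fix $\lambda>0$. There is a randomized algorithm that, for all sufficiently large $n$, outputs a partial triangulation of a convex $(n+2)$-gon distributed exactly according to $\pi_{n,\lambda}$, with expected running time $O\big((n\sqrt{\lambda}+1)\log n\big)$.
   Context: For $n\ge 1$ and $1\le k\le n$, let $\Omega_{n,k}$ be the set of partitions of a convex polygon with exactly $n+2$ sides into $k$ parts obtained by inserting exactly $k-1$ pairwise non-intersecting (non-crossing in their interiors) diagonals, and let $\Omega=\bigcup_{k=1}^n\Omega_{n,k}$ (the partial triangulations). For $\sigma\in\Omega$ let $|\sigma|$ denote its number of diagonals. For a real parameter $\lambda>0$, $\pi_{n,\lambda}$ is the probability distribution on $\Omega$ given by $\pi_{n,\lambda}(\sigma)=\lambda^{|\sigma|}/Z_{n,\lambda}$, where $Z_{n,\lambda}=\sum_{\tau\in\Omega}\lambda^{|\tau|}$. The model of computation is the RAM model in which arithmetic operations on real numbers take constant time, and the algorithm has access to a stream of independent uniformly random real numbers in $[0,1]$. *)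

theory Defs
  imports "HOL-Probability.Probability"
begin

section \<open>Partial triangulations of a convex polygon\<close>

text \<open>
  The vertices of the convex \<open>(n+2)\<close>-gon are \<open>0, \<dots>, n+1\<close> in cyclic order, and the diagonal joining
  \<open>i < j\<close> is the pair \<open>(i, j)\<close>. A partition of the polygon by diagonals is identified with its set
  of diagonals.
\<close>

definition diagonals :: "nat \<Rightarrow> (nat \<times> nat) set" where
  "diagonals n = {(i, j). i + 2 \<le> j \<and> j \<le> n + 1 \<and> (i, j) \<noteq> (0, n + 1)}"

fun crosses :: "nat \<times> nat \<Rightarrow> nat \<times> nat \<Rightarrow> bool" where
  "crosses (i, j) (a, b) \<longleftrightarrow> (i < a \<and> a < j \<and> j < b) \<or> (a < i \<and> i < b \<and> b < j)"

text \<open>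
  The combinatorial relation is the geometric one: for any polygon whose vertices
  \<open>v 0, \<dots>, v (m-1)\<close> are in strictly convex position, listed counterclockwise, two distinct chords
  cross iff their relative interiors meet.
\<close>

lemma crosses_iff_open_segments_meet:
  fixes v :: "nat \<Rightarrow> complex"
  assumes conv: "\<And>i j k. i < j \<Longrightarrow> j < k \<Longrightarrow> k < m \<Longrightarrow> Im (cnj (v j - v i) * (v k - v i)) > 0"
    and ij: "i < j" "j < m" and ab: "a < b" "b < m" and ne: "(i, j) \<noteq> (a, b)"
  shows "crosses (i, j) (a, b) \<longleftrightarrow> open_segment (v i) (v j) \<inter> open_segment (v a) (v b) \<noteq> {}"
proof -
  define D where "D p q r = Im (cnj (v q - v p) * (v r - v p))" for p q r
  have D_pos: "D p q r > 0" if "p < q" "q < r" "r < m" for p q r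
    using conv[OF that] by (simp add: D_def)
  have D_cyc: "D p q r = D q r p" "D p q r = - D q p r" for p q r
    by (simp_all add: D_def algebra_simps)
  have D_same: "D p q p = 0" "D p q q = 0" for p q
    by (simp_all add: D_def algebra_simps)
  have v_ne: "v p \<noteq> v r" if "p < q" "q < r" "r < m" for p q r
    using D_pos[OF that] by (auto simp: D_def algebra_simps)
  have meet: "open_segment (v p) (v r) \<inter> open_segment (v q) (v s) \<noteq> {}"
    if "p < q" "q < r" "r < s" "s < m" for p q r s
  proof -
    define al be ga de where "al = D q r s" and "be = D p q s" and "ga = D p r s" and "de = D p q r"
    note defs = al_def be_def ga_def de_def
    have pos: "al > 0" "be > 0" "ga > 0" "de > 0"
      using that by (auto simp: defs intro!: D_pos)
    have sum: "al + be = ga + de" by (simp add: defs D_def algebra_simps)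
    have rel: "al *\<^sub>R v p + be *\<^sub>R v r = ga *\<^sub>R v q + de *\<^sub>R v s"
      by (rule complex_eqI) (simp_all add: defs D_def algebra_simps)
    define u w where "u = be / (al + be)" and "w = de / (ga + de)"
    have u: "0 < u" "u < 1" "1 - u = al / (al + be)" and w: "0 < w" "w < 1" "1 - w = ga / (ga + de)"
      using pos by (simp_all add: u_def w_def field_simps)
    have "(1 - u) *\<^sub>R v p + u *\<^sub>R v r = (1 / (al + be)) *\<^sub>R (al *\<^sub>R v p + be *\<^sub>R v r)"
      unfolding u(3) by (simp add: u_def scaleR_right_distrib)
    also have "\<dots> = (1 - w) *\<^sub>R v q + w *\<^sub>R v s"
      unfolding rel sum w(3) by (simp add: w_def scaleR_right_distrib)
    finally have eq: "(1 - u) *\<^sub>R v p + u *\<^sub>R v r = (1 - w) *\<^sub>R v q + w *\<^sub>R v s" .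
    have "(1 - u) *\<^sub>R v p + u *\<^sub>R v r \<in> open_segment (v p) (v r)"
      unfolding in_segment using u v_ne[of p q r] that by auto
    moreover have "(1 - w) *\<^sub>R v q + w *\<^sub>R v s \<in> open_segment (v q) (v s)"
      unfolding in_segment using w v_ne[of q r s] that by auto
    ultimately have "(1 - u) *\<^sub>R v p + u *\<^sub>R v r \<in> open_segment (v p) (v r) \<inter> open_segment (v q) (v s)"
      unfolding eq by simp
    then show ?thesis by blast
  qed
  have disjoint: "open_segment (v i) (v j) \<inter> open_segment (v a) (v b) = {}"
    if "\<not> crosses (i, j) (a, b)"
  proof -
    define L where "L z = Im (cnj (v j - v i) * (z - v i))" for z
    have L_comb: "L ((1 - u) *\<^sub>R p + u *\<^sub>R q) = (1 - u) * L p + u * L q" for u p q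
      by (simp add: L_def algebra_simps)
    have L_D: "L (v k) = D i j k" for k
      by (simp add: L_def D_def)
    have inside: "L (v k) < 0" if "i < k" "k < j" for k
      using D_pos[of i k j] that ij unfolding L_D by (simp add: D_def algebra_simps)
    have outside: "L (v k) > 0" if "k < i \<or> j < k" "k < m" for k
      using D_pos[of k i j] D_pos[of i j k] D_cyc(1)[of k i j] that ij unfolding L_D by auto
    have on: "L (v i) = 0" "L (v j) = 0"
      by (simp_all add: L_D D_same)
    have within: "L (v k) \<le> 0" if "i \<le> k" "k \<le> j" for k
      using that inside[of k] on by (cases "k = i"; cases "k = j") auto
    have beyond: "L (v k) \<ge> 0" if "k \<le> i \<or> j \<le> k" "k < m" for k
      using that outside[of k] on by (cases "k = i"; cases "k = j") auto
    have zero: "k = i \<or> k = j" if "L (v k) = 0" "k < m" for k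
      using that inside[of k] outside[of k] by (metis less_irrefl linorder_cases)
    have "\<not> (L (v a) = 0 \<and> L (v b) = 0)"
      using zero[of a] zero[of b] ij ab ne by auto
    moreover have "(i \<le> a \<and> b \<le> j) \<or> (a \<le> i \<or> j \<le> a) \<and> (b \<le> i \<or> j \<le> b)"
      using \<open>\<not> crosses (i, j) (a, b)\<close> ij ab by auto
    then have "(L (v a) \<le> 0 \<and> L (v b) \<le> 0) \<or> (L (v a) \<ge> 0 \<and> L (v b) \<ge> 0)"
      using within[of a] within[of b] beyond[of a] beyond[of b] ab by auto
    ultimately consider "L (v a) < 0 \<and> L (v b) \<le> 0" | "L (v a) \<le> 0 \<and> L (v b) < 0"
      | "L (v a) > 0 \<and> L (v b) \<ge> 0" | "L (v a) \<ge> 0 \<and> L (v b) > 0"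
      by linarith
    then have off: "(1 - u) * L (v a) + u * L (v b) \<noteq> 0" if "0 < u" "u < 1" for u
    proof cases
      case 1
      then have "(1 - u) * L (v a) < 0" "u * L (v b) \<le> 0"
        using that by (simp_all add: mult_pos_neg mult_nonneg_nonpos)
      then show ?thesis by linarith
    next
      case 2
      then have "(1 - u) * L (v a) \<le> 0" "u * L (v b) < 0"
        using that by (simp_all add: mult_pos_neg mult_nonneg_nonpos)
      then show ?thesis by linarith
    next
      case 3
      then have "(1 - u) * L (v a) > 0" "u * L (v b) \<ge> 0"
        using that by simp_all
      then show ?thesis by linarith
    next
      case 4
      then have "(1 - u) * L (v a) \<ge> 0" "u * L (v b) > 0"
        using that by simp_all
      then show ?thesis by linarith
    qed
    have "L x = 0" if "x \<in> open_segment (v i) (v j)" for x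
      using that L_comb[of _ "v i" "v j"] on by (auto simp: in_segment)
    moreover have "L x \<noteq> 0" if x: "x \<in> open_segment (v a) (v b)" for x
    proof -
      obtain u where "0 < u" "u < 1" "x = (1 - u) *\<^sub>R v a + u *\<^sub>R v b"
        using x by (auto simp: in_segment)
      then show ?thesis using off[of u] L_comb[of u "v a" "v b"] by simp
    qed
    ultimately show ?thesis by blast
  qed
  have "open_segment (v i) (v j) \<inter> open_segment (v a) (v b) \<noteq> {}" if "crosses (i, j) (a, b)"
    using that meet[of i a j b] meet[of a i b j] ij ab by auto
  with disjoint show ?thesis by blast
qed

definition Omega_k :: "nat \<Rightarrow> nat \<Rightarrow> (nat \<times> nat) set set" where
  "Omega_k n k = {\<sigma>. \<sigma> \<subseteq> diagonals n \<and> card \<sigma> = k - 1 \<and> (\<forall>d\<in>\<sigma>. \<forall>e\<in>\<sigma>. \<not> crosses d e)}"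

definition Omega :: "nat \<Rightarrow> (nat \<times> nat) set set" where
  "Omega n = (\<Union>k\<in>{1..n}. Omega_k n k)"

definition Z_sum :: "nat \<Rightarrow> real \<Rightarrow> real" where
  "Z_sum n lam = (\<Sum>\<tau>\<in>Omega n. lam ^ card \<tau>)"

definition pi_dist :: "nat \<Rightarrow> real \<Rightarrow> (nat \<times> nat) set \<Rightarrow> real" where
  "pi_dist n lam \<sigma> = lam ^ card \<sigma> / Z_sum n lam"


section \<open>A randomized real RAM\<close>

text \<open>
  A program uses real-valued registers, a real-valued random-access memory reached only through
  \<open>Load\<close> and \<open>Store\<close>, and a stream of random reals read one at a time by \<open>Draw\<close>. Every instruction
  takes one unit of time. Program constants are integers, so no information can be hidden in
  them; there is no rounding instruction.
\<close>

datatype arith_op = Plus | Minus | Times | Divide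

datatype instr =
    Const nat int
  | Move nat nat
  | Arith arith_op nat nat nat
  | Load nat nat
  | Store nat nat
  | Draw nat
  | Jump nat
  | JumpLess nat nat nat

record config =
  pc :: nat
  reg :: "nat \<Rightarrow> real"
  mem :: "nat \<Rightarrow> real"
  rnd :: "real stream"

fun arith :: "arith_op \<Rightarrow> real \<Rightarrow> real \<Rightarrow> real" where
  "arith Plus x y = x + y"
| "arith Minus x y = x - y"
| "arith Times x y = x * y"
| "arith Divide x y = x / y"

abbreviation set_reg :: "nat \<Rightarrow> real \<Rightarrow> config \<Rightarrow> config" where
  "set_reg a x c \<equiv> c\<lparr>pc := Suc (pc c), reg := (reg c)(a := x)\<rparr>"

text \<open>
  Using a value that is not a natural number as an address leaves the configuration unchanged, so
  the machine then runs forever; in particular addressing cannot be used to round reals.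
\<close>

fun exec :: "instr \<Rightarrow> config \<Rightarrow> config" where
  "exec (Const a z) c = set_reg a (of_int z) c"
| "exec (Move a b) c = set_reg a (reg c b) c"
| "exec (Arith f a b d) c = set_reg a (arith f (reg c b) (reg c d)) c"
| "exec (Load a b) c =
     (if reg c b \<in> \<nat> then set_reg a (mem c (nat \<lfloor>reg c b\<rfloor>)) c else c)"
| "exec (Store a b) c =
     (if reg c a \<in> \<nat> then c\<lparr>pc := Suc (pc c), mem := (mem c)(nat \<lfloor>reg c a\<rfloor> := reg c b)\<rparr> else c)"
| "exec (Draw a) c = (set_reg a (shd (rnd c)) c)\<lparr>rnd := stl (rnd c)\<rparr>"
| "exec (Jump l) c = c\<lparr>pc := l\<rparr>"
| "exec (JumpLess a b l) c = c\<lparr>pc := (if reg c a < reg c b then l else Suc (pc c))\<rparr>"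

definition halted :: "instr list \<Rightarrow> config \<Rightarrow> bool" where
  "halted P c \<longleftrightarrow> pc c \<ge> length P"

definition step :: "instr list \<Rightarrow> config \<Rightarrow> config" where
  "step P c = (if halted P c then c else exec (P ! pc c) c)"

definition init :: "nat \<Rightarrow> real \<Rightarrow> real stream \<Rightarrow> config" where
  "init n lam \<omega> =
     \<lparr>pc = 0, reg = (\<lambda>_. 0)(0 := real n, 1 := lam), mem = (\<lambda>_. 0), rnd = \<omega>\<rparr>"

definition run :: "instr list \<Rightarrow> nat \<Rightarrow> real \<Rightarrow> real stream \<Rightarrow> nat \<Rightarrow> config" where
  "run P n lam \<omega> t = (step P ^^ t) (init n lam \<omega>)"

definition run_time :: "instr list \<Rightarrow> nat \<Rightarrow> real \<Rightarrow> real stream \<Rightarrow> ennreal" where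
  "run_time P n lam \<omega> = (INF t\<in>{t. halted P (run P n lam \<omega> t)}. of_nat t)"

text \<open>
  A set of diagonals is output as a list without repetitions: its length in register 0, and the two
  endpoints of the \<open>t\<close>-th diagonal in memory cells \<open>2t\<close> and \<open>2t+1\<close>.
\<close>

definition encodes :: "config \<Rightarrow> (nat \<times> nat) set \<Rightarrow> bool" where
  "encodes c \<sigma> \<longleftrightarrow> (\<exists>ds. distinct ds \<and> set ds = \<sigma> \<and> reg c 0 = real (length ds) \<and>
     (\<forall>t<length ds. mem c (2 * t) = real (fst (ds ! t)) \<and> mem c (2 * t + 1) = real (snd (ds ! t))))"

definition outputs :: "instr list \<Rightarrow> nat \<Rightarrow> real \<Rightarrow> real stream \<Rightarrow> (nat \<times> nat) set \<Rightarrow> bool" where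
  "outputs P n lam \<omega> \<sigma> \<longleftrightarrow> (\<exists>t. halted P (run P n lam \<omega> t) \<and> encodes (run P n lam \<omega> t) \<sigma>)"

definition uniform_stream :: "real stream measure" where
  "uniform_stream = stream_space (uniform_measure lborel {0..1})"

end

theory Submission
  imports Defs
begin

text \<open>
  A dissection is a plane tree without unary nodes. Write it in preorder over the alphabet
  \<open>Push\<close> (a leaf), \<open>Cut\<close> (a node with two children) and \<open>Pop\<close> (one more child for the node just
  opened). The number of ways to complete a prefix of such a word with given numbers of remaining
  nodes and surplus children has a closed form (a ballot number times a binomial coefficient), and
  so has the number of words with \<open>d\<close> diagonals. Hence one can first draw \<open>d\<close> with the correct
  weight and then the word letter by letter, each time comparing a uniform number with a ratio of
  two completion counts; every decision takes constant time and there are \<open>O(n)\<close> of them. Read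
  from its end, the word is a program for a stack machine that writes down the diagonals. The
  running time is at most \<open>220 n\<close> almost surely, which is below \<open>n \<surd>\<lambda> ln n\<close> for large \<open>n\<close>.
\<close>

section \<open>Dissections as words\<close>

text \<open>Drawing \<open>d\<close> first fixes the numbers of nodes and of surplus children, so
  all completions of a prefix carry the same power of \<open>lam\<close>. Otherwise their weight
  would be a sum over the numbers of nodes still possible; for fixed \<open>d\<close> it is a
  product of factorials, and neighbouring ones have as quotient a rational function of
  \<open>p\<close>, \<open>i\<close> and \<open>x\<close>. Choosing a degree by successive
  \<open>Pop\<close> decisions keeps every decision binary, and no decision ever splits sizes among
  subtrees, which would call for a convolution. Preorder is used because the number \<open>p\<close>
  of subtrees still owed then says enough about the prefix; the word is executed backwards because
  the chord of a node can be written only when the vertices below that node are known. The one-step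
  identities between counts do double duty: by induction they prove the closed forms correct, and
  along a word they telescope to its probability.\<close>

definition noncrossing :: "nat \<Rightarrow> (nat \<times> nat) set \<Rightarrow> bool" where
  "noncrossing l D \<longleftrightarrow> D \<subseteq> {(a, b). a + 2 \<le> b \<and> b \<le> l} \<and> (\<forall>d\<in>D. \<forall>e\<in>D. \<not> crosses d e)"

text \<open>
  The outer chain of \<open>D\<close> at \<open>v\<close> is the path from \<open>v\<close> down to \<open>0\<close> that always takes the longest
  chord or, failing that, the side of the polygon. The vertices that no chord covers are exactly
  those on this path.
\<close>

definition outer :: "(nat \<times> nat) set \<Rightarrow> nat \<Rightarrow> nat" where
  "outer D v = (LEAST k. Suc k = v \<or> (k, v) \<in> D)"

lemma outer_le: "v > 0 \<Longrightarrow> outer D v < v"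
  unfolding outer_def using Least_le[of "\<lambda>k. Suc k = v \<or> (k, v) \<in> D" "v - 1"] by force

lemma outer_cases: "v > 0 \<Longrightarrow> Suc (outer D v) = v \<or> (outer D v, v) \<in> D"
  unfolding outer_def using LeastI[of "\<lambda>k. Suc k = v \<or> (k, v) \<in> D" "v - 1"] by force

lemma outer_least: "(k, v) \<in> D \<Longrightarrow> outer D v \<le> k"
  unfolding outer_def by (rule Least_le) blast

lemma outer_eqI:
  assumes "Suc a = v \<or> (a, v) \<in> D" "a < v" "\<And>k. (k, v) \<in> D \<Longrightarrow> a \<le> k"
  shows "outer D v = a"
  unfolding outer_def by (rule Least_equality) (use assms in auto)

function chain :: "(nat \<times> nat) set \<Rightarrow> nat \<Rightarrow> nat list" where
  "chain D v = (if v = 0 then [] else outer D v # chain D (outer D v))"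
  by pat_completeness auto
termination by (relation "Wellfounded.measure snd") (auto simp: outer_le)

declare chain.simps [simp del]

lemma chain_0 [simp]: "chain D 0 = []"
  by (simp add: chain.simps)

lemma chain_pos: "v > 0 \<Longrightarrow> chain D v = outer D v # chain D (outer D v)"
  by (subst chain.simps) simp

lemma chain_lt: "a \<in> set (chain D v) \<Longrightarrow> a < v"
proof (induction v rule: less_induct)
  case (less v)
  show ?case
  proof (cases "v = 0")
    case False
    then show ?thesis
      using less.prems less.IH[of "outer D v"] outer_le[of v D] chain_pos[of v D]
      by (auto dest: less_trans)
  qed (use less.prems in simp)
qed

lemma chain_drop: "k < length (chain D v) \<Longrightarrow> drop (Suc k) (chain D v) = chain D (chain D v ! k)"
proof (induction k arbitrary: v)
  case 0
  then show ?case by (cases "v = 0") (simp_all add: chain_pos)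
next
  case (Suc k)
  then show ?case by (cases "v = 0") (simp_all add: chain_pos)
qed

lemma chain_cong:
  assumes "\<And>a b. b \<le> v \<Longrightarrow> (a, b) \<in> D \<longleftrightarrow> (a, b) \<in> D'"
  shows "chain D v = chain D' v"
  using assms
proof (induction v rule: less_induct)
  case (less v)
  show ?case
  proof (cases "v = 0")
    case False
    have "outer D v = outer D' v"
      unfolding outer_def using less.prems by simp
    moreover have "chain D (outer D v) = chain D' (outer D v)"
      using less.IH less.prems outer_le[of v D] False by simp
    ultimately show ?thesis using False by (simp add: chain_pos)
  qed simp
qed

text \<open>A chord covering a chain vertex either ends at or below \<open>outer D v\<close>, where
  induction applies, or straddles it. A straddling chord cannot end at \<open>v\<close>, by
  minimality of \<open>outer\<close>, so it crosses the chord \<open>(outer D v, v)\<close>.\<close>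

lemma chain_uncovered:
  assumes "noncrossing l D" "a \<in> set (chain D v)" "v \<le> l" "(b, c) \<in> D" "b < a" "a < c" "c \<le> v"
  shows False
  using assms(2-)
proof (induction v rule: less_induct)
  case (less v)
  have v: "v > 0" using less.prems by (cases v) auto
  define k where "k = outer D v"
  have kv: "k < v" using outer_le[OF v, of D] by (simp add: k_def)
  have a: "a = k \<or> a \<in> set (chain D k)"
    using less.prems(1) chain_pos[OF v, of D] by (simp add: k_def)
  then have ak: "a \<le> k" using chain_lt[of a D k] by auto
  show False
  proof (cases "c \<le> k")
    case True
    then have "a \<in> set (chain D k)" using a less.prems by auto
    then show False using less.IH[of k] kv less.prems True by auto
  next
    case False
    have "b < k" using less.prems ak by simp
    then have "c \<noteq> v" using less.prems outer_least[of b v D] by (auto simp: k_def)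
    then have cv: "c < v" using less.prems by simp
    then have "(k, v) \<in> D" using outer_cases[OF v, of D] False by (auto simp: k_def)
    moreover have "crosses (b, c) (k, v)" using \<open>b < k\<close> False cv by simp
    ultimately show False using assms(1) less.prems unfolding noncrossing_def by blast
  qed
qed

text \<open>The path can miss \<open>a\<close> only by jumping over it, and a jump of more than one
  vertex is itself a chord covering \<open>a\<close>.\<close>

lemma uncovered_in_chain:
  assumes "\<And>b c. (b, c) \<in> D \<Longrightarrow> b < a \<Longrightarrow> a < c \<Longrightarrow> c \<le> v \<Longrightarrow> False" "a < v"
  shows "a \<in> set (chain D v)"
  using assms
proof (induction v rule: less_induct)
  case (less v)
  have v: "v > 0" using less.prems by simp
  consider "outer D v = a" | "a < outer D v" | "outer D v < a" by linarith
  then show ?case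
  proof cases
    case 1
    then show ?thesis using chain_pos[OF v, of D] by simp
  next
    case 2
    have "a \<in> set (chain D (outer D v))"
      using less.IH[OF outer_le[OF v]] 2 less.prems(1) outer_le[OF v, of D] by (meson less_imp_le order_trans)
    then show ?thesis using chain_pos[OF v, of D] by simp
  next
    case 3
    then have "(outer D v, v) \<in> D" using outer_cases[OF v, of D] less.prems by auto
    then show ?thesis using less.prems 3 by blast
  qed
qed

lemma noncrossing_mono: "noncrossing l D \<Longrightarrow> l \<le> m \<Longrightarrow> noncrossing m D"
  unfolding noncrossing_def by fastforce

lemma noncrossing_subset: "noncrossing l D \<Longrightarrow> D' \<subseteq> D \<Longrightarrow> noncrossing l D'"
  unfolding noncrossing_def by blast

lemma noncrossing_bounds: "noncrossing l D \<Longrightarrow> (a, b) \<in> D \<Longrightarrow> a + 2 \<le> b \<and> b \<le> l"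
  unfolding noncrossing_def by blast

lemma noncrossing_finite: "noncrossing l D \<Longrightarrow> finite D"
proof (rule finite_subset)
  assume "noncrossing l D"
  then show "D \<subseteq> {..l} \<times> {..l}" unfolding noncrossing_def by auto
qed simp

text \<open>The gaps between consecutive chain vertices are the top-level subtrees. The new chord
  joins the \<open>k + 2\<close> rightmost ones under one node, and a chord crossing it would have
  to cover the chain vertex \<open>a\<close>.\<close>

lemma insert_chord:
  assumes D: "noncrossing v D" and k: "Suc k < length (chain D v)" and a: "a = chain D v ! Suc k"
  shows "noncrossing v (insert (a, v) D)" "(a, v) \<notin> D"
    "chain (insert (a, v) D) v = drop (Suc k) (chain D v)"
proof -
  have v: "v > 0" using k by (cases v) auto
  define b where "b = outer D v"
  have bv: "b < v" using outer_le[OF v] by (simp add: b_def)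
  have ch: "chain D v = b # chain D b" using chain_pos[OF v] by (simp add: b_def)
  have "a \<in> set (chain D b)" using k a ch by auto
  then have ab: "a < b" and av: "a \<in> set (chain D v)" using chain_lt ch by auto
  show notin: "(a, v) \<notin> D" using outer_least[of a v D] ab by (auto simp: b_def)
  have le: "a \<le> c" if "(c, v) \<in> D" for c
    using outer_least[OF that] ab by (simp add: b_def)
  have "\<not> crosses (c, d) (a, v) \<and> \<not> crosses (a, v) (c, d)" if "(c, d) \<in> D" for c d
    using chain_uncovered[OF D av order_refl that] noncrossing_bounds[OF D that] by auto
  then show "noncrossing v (insert (a, v) D)"
    using D ab bv unfolding noncrossing_def by auto
  have "outer (insert (a, v) D) v = a"
    by (rule outer_eqI) (use le ab bv in auto)
  then have "chain (insert (a, v) D) v = a # chain (insert (a, v) D) a"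
    using chain_pos[OF v] by simp
  also have "chain (insert (a, v) D) a = chain D a"
    by (rule chain_cong) (use ab bv in auto)
  also have "\<dots> = drop (Suc (Suc k)) (chain D v)"
    using chain_drop[OF k] a by simp
  finally show "chain (insert (a, v) D) v = drop (Suc k) (chain D v)"
    using a Cons_nth_drop_Suc[OF k] by simp
qed

text \<open>This undoes \<open>insert_chord\<close> for the longest chord at \<open>v\<close>. Every
  other chord at \<open>v\<close> starts to the right of \<open>a\<close>, so nothing covers
  \<open>a\<close> once \<open>(a, v)\<close> is gone.\<close>

lemma remove_chord:
  assumes D: "noncrossing v D" and v: "v > 0" and a: "a = outer D v" "Suc a \<noteq> v"
  defines "D' \<equiv> D - {(a, v)}"
  shows "noncrossing v D'" "(a, v) \<in> D" "\<exists>k. Suc k < length (chain D' v) \<and> chain D' v ! Suc k = a"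
proof -
  show av: "(a, v) \<in> D" using outer_cases[OF v, of D] a by auto
  show "noncrossing v D'" using D by (rule noncrossing_subset) (auto simp: D'_def)
  have "a \<in> set (chain D' v)"
  proof (rule uncovered_in_chain)
    fix b c assume bc: "(b, c) \<in> D'" "b < a" "a < c" "c \<le> v"
    then have "c \<noteq> v" using outer_least[of b v D] a by (auto simp: D'_def)
    then have "crosses (b, c) (a, v)" using bc by simp
    then show False using D bc av unfolding noncrossing_def D'_def by blast
  qed (use outer_le[OF v] a in simp)
  then obtain m where m: "m < length (chain D' v)" "chain D' v ! m = a"
    by (auto simp: in_set_conv_nth)
  have "outer D' v \<noteq> a" using outer_cases[OF v, of D'] a by (auto simp: D'_def)
  then have "m \<noteq> 0" using m chain_pos[OF v, of D'] by (auto intro: gr0I)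
  then show "\<exists>k. Suc k < length (chain D' v) \<and> chain D' v ! Suc k = a"
    using m by (cases m) auto
qed

section \<open>Words, decision sequences and the stack machine\<close>

datatype letter = Push | Pop | Cut

text \<open>
  In \<open>Open p i x\<close> and \<open>Pend p i x\<close>, \<open>p\<close> subtrees are still to be written and \<open>i\<close> nodes and \<open>x\<close>
  surplus children have still to be placed, so that \<open>p + i + x\<close> leaves remain. Surplus children
  may be added only directly after a \<open>Cut\<close> or \<open>Pop\<close>, which is the state \<open>Open\<close>; the run starts
  there with \<open>p = 2\<close> because the root is left implicit. In \<open>Size d\<close> the number of diagonals is
  known to be at least \<open>d\<close>.
\<close>

datatype state = Size nat | Open nat nat nat | Pend nat nat nat

fun available :: "nat \<Rightarrow> state \<Rightarrow> bool \<Rightarrow> bool" where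
  "available n (Size d) b \<longleftrightarrow> d < n"
| "available n (Open p i x) b \<longleftrightarrow> p > 0 \<and> (b \<longrightarrow> x > 0)"
| "available n (Pend p i x) b \<longleftrightarrow> p > 0 \<and> (b \<longrightarrow> i > 0)"

fun next_state :: "nat \<Rightarrow> state \<Rightarrow> bool \<Rightarrow> state" where
  "next_state n (Size d) b = (if b then Open 2 d (n - 1 - d) else Size (Suc d))"
| "next_state n (Open p i x) b = (if b then Open (Suc p) i (x - 1) else Pend p i x)"
| "next_state n (Pend p i x) b = (if b then Open (Suc p) (i - 1) x else Pend (p - 1) i x)"

fun emitted :: "state \<Rightarrow> bool \<Rightarrow> letter list" where
  "emitted (Size d) b = []"
| "emitted (Open p i x) b = (if b then [Pop] else [])"
| "emitted (Pend p i x) b = (if b then [Cut] else [Push])"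

primrec accepts :: "nat \<Rightarrow> state \<Rightarrow> bool list \<Rightarrow> bool" where
  "accepts n s [] \<longleftrightarrow> s = Pend 0 0 0"
| "accepts n s (b # bs) \<longleftrightarrow> available n s b \<and> accepts n (next_state n s b) bs"

primrec letters :: "nat \<Rightarrow> state \<Rightarrow> bool list \<Rightarrow> letter list" where
  "letters n s [] = []"
| "letters n s (b # bs) = emitted s b @ letters n (next_state n s b) bs"

text \<open>
  A stack \<open>(v, r, e)\<close> consists of the current vertex, the earlier vertices still on the stack and
  the diagonals written so far.
\<close>

type_synonym stack = "nat \<times> nat list \<times> (nat \<times> nat) list"

text \<open>The stack holds the left endpoints of the finished subtrees, the rightmost on top. A
  node with \<open>j + 2\<close> children is met as \<open>j\<close> times \<open>Pop\<close> and
  then \<open>Cut\<close>; together they discard \<open>j + 1\<close> endpoints, and the one left on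
  top is where the chord of the node starts.\<close>

fun act :: "letter \<Rightarrow> stack \<Rightarrow> stack" where
  "act Push (v, r, e) = (Suc v, v # r, e)"
| "act Pop (v, r, e) = (v, tl r, e)"
| "act Cut (v, r, e) = (v, tl r, e @ [(hd (tl r), v)])"

definition decode :: "letter list \<Rightarrow> stack" where
  "decode w = foldr act w (0, [], [])"

lemma decode_simps [simp]: "decode [] = (0, [], [])" "decode (a # w) = act a (decode w)"
  by (simp_all add: decode_def)

text \<open>The invariant concerns the stack built from the letters still to come. Leaves are sides
  of the polygon, whence \<open>v = p + i + x\<close>. In \<open>Open\<close> those letters may
  begin with \<open>Pop\<close>s, which are executed last and have removed \<open>j\<close> chain
  vertices.\<close>

fun represents :: "state \<Rightarrow> stack \<Rightarrow> bool" where
  "represents (Size d) t \<longleftrightarrow> True"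
| "represents (Open p i x) (v, r, e) \<longleftrightarrow> v = p + i + x \<and> noncrossing v (set e) \<and> distinct e \<and>
     length e = i \<and> length r = p \<and> (\<exists>j. r = drop j (chain (set e) v))"
| "represents (Pend p i x) (v, r, e) \<longleftrightarrow> v = p + i + x \<and> noncrossing v (set e) \<and> distinct e \<and>
     length e = i \<and> length r = p \<and> r = chain (set e) v"

lemma accepts_represents: "accepts n s bs \<Longrightarrow> represents s (decode (letters n s bs))"
proof (induction bs arbitrary: s)
  case Nil
  then show ?case by (simp add: noncrossing_def)
next
  case (Cons b bs)
  define s' where "s' = next_state n s b"
  obtain v r e where vre: "decode (letters n s' bs) = (v, r, e)" by (metis prod_cases3)
  have IH: "represents s' (v, r, e)" using Cons.IH[of s'] Cons.prems vre by (simp add: s'_def)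
  have dec: "decode (letters n s (b # bs)) = foldr act (emitted s b) (v, r, e)"
    using vre by (simp add: s'_def decode_def)
  show ?case
  proof (cases s)
    case (Size d)
    then show ?thesis by simp
  next
    case (Open p i x)
    show ?thesis
    proof (cases b)
      case True
      then show ?thesis using IH Cons.prems dec Open
        by (auto simp: s'_def drop_Suc[symmetric] tl_drop)
    next
      case False
      then show ?thesis using IH dec Open by (auto simp: s'_def) (metis drop0)
    qed
  next
    case (Pend p i x)
    show ?thesis
    proof (cases b)
      case True
      then have ip: "i > 0" "p > 0" using Cons.prems Pend by auto
      from True IH Pend obtain j where j: "v = Suc p + (i - 1) + x" "noncrossing v (set e)"
        "distinct e" "length e = i - 1" "length r = Suc p" "r = drop j (chain (set e) v)"
        by (auto simp: s'_def)
      have tl: "tl r = drop (Suc j) (chain (set e) v)"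
        using j by (simp add: drop_Suc tl_drop)
      \<comment> \<open>\<open>p > 0\<close> subtrees are owed before the \<open>Cut\<close> and one
        more after it, so \<open>r\<close> has at least two entries and the chord finds its left
        endpoint.\<close>
      have len: "Suc j < length (chain (set e) v)"
        using j(5) ip by (simp add: j(6))
      have hd: "hd (tl r) = chain (set e) v ! Suc j"
        using tl len by (simp add: hd_drop_conv_nth)
      note ins = insert_chord[OF j(2) len hd]
      show ?thesis using True Pend dec ins tl j ip by auto
    next
      case False
      then have ip: "p > 0" using Cons.prems Pend by auto
      from False IH Pend have j: "v = p - 1 + i + x" "noncrossing v (set e)"
        "distinct e" "length e = i" "length r = p - 1" "r = chain (set e) v"
        by (auto simp: s'_def)
      have "outer (set e) (Suc v) = v"
        by (rule outer_eqI) (use noncrossing_bounds[OF j(2)] in fastforce)+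
      then have "chain (set e) (Suc v) = v # r" using chain_pos[of "Suc v"] j by simp
      then show ?thesis using False Pend dec j ip noncrossing_mono[OF j(2), of "Suc v"] by auto
    qed
  qed
qed

definition chords :: "nat \<Rightarrow> state \<Rightarrow> bool list \<Rightarrow> (nat \<times> nat) list" where
  "chords n s bs = snd (snd (decode (letters n s bs)))"

text \<open>
  The first decision can be read off the decoded set: a chord ends at the last vertex iff the first
  letter is \<open>Cut\<close>, and surplus children are pending iff the outer chain is longer than \<open>p\<close>.
\<close>

lemma accepts_inj:
  assumes "accepts n s bs" "accepts n s bs'" "set (chords n s bs) = set (chords n s bs')" "\<forall>d. s \<noteq> Size d"
  shows "bs = bs'"
  using assms
proof (induction bs arbitrary: s bs')
  case Nil
  then show ?case by (cases bs') auto
next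
  case (Cons b bs)
  then obtain b' cs where bs': "bs' = b' # cs" by (cases bs') auto
  obtain v r e where d1: "decode (letters n (next_state n s b) bs) = (v, r, e)" by (metis prod_cases3)
  obtain v' r' e' where d2: "decode (letters n (next_state n s b') cs) = (v', r', e')" by (metis prod_cases3)
  have R: "represents (next_state n s b) (v, r, e)" "represents (next_state n s b') (v', r', e')"
    using accepts_represents[of n _ bs] accepts_represents[of n _ cs] Cons.prems bs' d1 d2 by force+
  have full: "represents s (decode (letters n s (b # bs)))" "represents s (decode (letters n s (b' # cs)))"
    using accepts_represents Cons.prems bs' by blast+
  have eqs: "set (snd (snd (foldr act (emitted s b) (v, r, e)))) = set (snd (snd (foldr act (emitted s b') (v', r', e'))))"
    using Cons.prems(3) d1 d2 bs' by (simp add: chords_def decode_def)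
  have full': "represents s (foldr act (emitted s b) (v, r, e))" "represents s (foldr act (emitted s b') (v', r', e'))"
    using full d1 d2 by (simp_all add: decode_def)
  have *: "b = b' \<and> set e = set e'"
  proof (cases s)
    case (Size d)
    then show ?thesis using Cons.prems by blast
  next
    case (Open p i x)
    have "set e = set e'" using eqs Open by (cases b; cases b') auto
    moreover have "length (chain (set e) v) = p \<longleftrightarrow> \<not> b"
      using R(1) Open by (cases b) auto
    moreover have "length (chain (set e') v') = p \<longleftrightarrow> \<not> b'"
      using R(2) Open by (cases b') auto
    moreover have "v = v'" using full' Open by (cases b; cases b') auto
    ultimately show ?thesis by simp
  next
    case (Pend p i x)
    define D where "D = set (snd (snd (foldr act (emitted s b) (v, r, e))))"
    have D2: "D = set (snd (snd (foldr act (emitted s b') (v', r', e'))))"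
      by (simp only: D_def eqs)
    have bb: "\<exists>a. (a, p + i + x) \<in> D" if "b" using that R(1) full' Pend by (auto simp: D_def)
    have bb': "\<exists>a. (a, p + i + x) \<in> D" if "b'" using that R(2) full' Pend by (auto simp: D2)
    have nb: "\<not> (\<exists>a. (a, p + i + x) \<in> D)" if "\<not> b"
      using that R(1) full'(1) Pend noncrossing_bounds[of v "set e"] by (fastforce simp: D_def)
    have nb': "\<not> (\<exists>a. (a, p + i + x) \<in> D)" if "\<not> b'"
      using that R(2) full'(2) Pend noncrossing_bounds[of v' "set e'"] by (fastforce simp: D2)
    have b: "b = b'" using bb bb' nb nb' by blast
    show ?thesis
    proof (cases b)
      case False
      then show ?thesis using b eqs Pend by auto
    next
      case True
      \<comment> \<open>\<open>D\<close> alone determines \<open>tl r\<close>, hence the chord that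
        \<open>Cut\<close> added; taking it away from \<open>D\<close> leaves equal sets.\<close>
      have "tl r = chain D v" "v = p + i + x" "(hd (tl r), v) \<notin> set e" "D = insert (hd (tl r), v) (set e)"
        using True Pend full'(1) by (auto simp: D_def)
      moreover have "tl r' = chain D v'" "v' = p + i + x" "(hd (tl r'), v') \<notin> set e'"
        "D = insert (hd (tl r'), v') (set e')"
        using True b Pend full'(2) by (auto simp: D2)
      ultimately show ?thesis using b by (metis insert_ident)
    qed
  qed
  have "bs = cs"
    by (rule Cons.IH[of "next_state n s b"])
      (use Cons.prems bs' * d1 d2 in \<open>cases s; auto simp: chords_def\<close>)+
  then show ?case using bs' * by simp
qed

lemma accepts_pops:
  assumes "accepts n (Pend (p + m) i x) bs" "p > 0"
  shows "accepts n (Open p i (x + m)) (replicate m True @ False # bs)"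
    "letters n (Open p i (x + m)) (replicate m True @ False # bs) = replicate m Pop @ letters n (Pend (p + m) i x) bs"
  using assms by (induction m arbitrary: p) auto

lemma decode_pops: "decode w = (v, r, e) \<Longrightarrow> decode (replicate m Pop @ w) = (v, drop m r, e)"
  by (induction m) (simp_all add: drop_Suc tl_drop)

text \<open>The induction undoes the last action of the machine. If no chord ends at
  \<open>l\<close>, vertex \<open>l\<close> came from a \<open>Push\<close> and is dropped;
  otherwise the longest chord at \<open>l\<close> was written last and is removed. Either way
  \<open>l + card D\<close> decreases.\<close>

lemma accepts_exists:
  assumes "noncrossing l D"
  shows "\<exists>x bs. l = length (chain D l) + card D + x \<and> accepts n (Pend (length (chain D l)) (card D) x) bs \<and>
    set (chords n (Pend (length (chain D l)) (card D) x) bs) = D"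
  using assms
proof (induction "l + card D" arbitrary: l D rule: less_induct)
  case less
  consider "l = 0" | "l > 0" "Suc (outer D l) = l" | "l > 0" "Suc (outer D l) \<noteq> l" by auto
  then show ?case
  proof cases
    case 1
    then have "D = {}" using less.prems by (auto simp: noncrossing_def)
    then show ?thesis using 1 by (auto intro!: exI[of _ "[]"] simp: chords_def)
  next
    case 2
    then obtain m where m: "l = Suc m" by (cases l) auto
    have out: "outer D l = m" using 2 m by simp
    have "b \<le> m" if "(a, b) \<in> D" for a b
    proof (rule ccontr)
      assume "\<not> b \<le> m"
      then have "b = l" using noncrossing_bounds[OF less.prems that] m by auto
      then show False
        using outer_least[of a l D] noncrossing_bounds[OF less.prems that] that out m by auto
    qed
    then have D: "noncrossing m D" using less.prems by (auto simp: noncrossing_def)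
    have ch: "chain D l = m # chain D m" using chain_pos[of l D] 2 out by simp
    obtain x bs where IH: "m = length (chain D m) + card D + x"
      "accepts n (Pend (length (chain D m)) (card D) x) bs"
      "set (chords n (Pend (length (chain D m)) (card D) x) bs) = D"
      using less.hyps[OF _ D] m by auto
    obtain v r e where vre: "decode (letters n (Pend (length (chain D m)) (card D) x) bs) = (v, r, e)"
      by (metis prod_cases3)
    have len: "length (chain D l) = Suc (length (chain D m))" by (simp add: ch)
    have "l = length (chain D l) + card D + x" using IH(1) m len by simp
    moreover have "accepts n (Pend (length (chain D l)) (card D) x) (False # bs)"
      using IH(2) len by simp
    moreover have "set (chords n (Pend (length (chain D l)) (card D) x) (False # bs)) = D"
      using IH(3) vre len by (simp add: chords_def)
    ultimately show ?thesis by blast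
  next
    case 3
    define a D' where "a = outer D l" and "D' = D - {(a, l)}"
    note rem = remove_chord[OF less.prems 3(1) a_def, folded D'_def]
    have D': "noncrossing l D'" and al: "(a, l) \<in> D" using rem 3 by (auto simp: a_def)
    obtain k where k: "Suc k < length (chain D' l)" "chain D' l ! Suc k = a"
      using rem 3 by (auto simp: a_def)
    have fin: "finite D" using noncrossing_finite[OF less.prems] .
    have card: "card D = Suc (card D')" using al fin card_Suc_Diff1[OF fin al] by (simp add: D'_def)
    have ins: "insert (a, l) D' = D" using al by (auto simp: D'_def)
    have chD: "chain D l = drop (Suc k) (chain D' l)"
      using insert_chord(3)[OF D' k(1) k(2)[symmetric]] ins by simp
    obtain x bs where IH: "l = length (chain D' l) + card D' + x"
      "accepts n (Pend (length (chain D' l)) (card D') x) bs"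
      "set (chords n (Pend (length (chain D' l)) (card D') x) bs) = D'"
      using less.hyps[OF _ D'] card by auto
    define p where "p = length (chain D l)"
    have p: "p > 0" "length (chain D' l) = Suc p + k" using chD k(1) by (auto simp: p_def)
    let ?s = "Pend (length (chain D' l)) (card D') x"
    obtain v r e where vre: "decode (letters n ?s bs) = (v, r, e)" by (metis prod_cases3)
    have R: "v = l" "r = chain D' l" "set e = D'"
      using accepts_represents[OF IH(2)] vre IH by (auto simp: chords_def)
    \<comment> \<open>Removing the chord exposes \<open>k + 2\<close> subtrees in place of one: two
      obligatory children and \<open>k\<close> surplus ones, hence \<open>k\<close>
      \<open>Pop\<close>s.\<close>
    define cs where "cs = replicate k True @ False # bs"
    have cs: "accepts n (Open (Suc p) (card D') (x + k)) cs"
      "letters n (Open (Suc p) (card D') (x + k)) cs = replicate k Pop @ letters n ?s bs"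
      using accepts_pops[of n "Suc p" k "card D'" x bs] IH(2) p unfolding cs_def by auto
    have dec: "decode (letters n (Pend p (card D) (x + k)) (True # cs)) = (l, chain D l, e @ [(a, l)])"
    proof -
      have t: "tl (drop k (chain D' l)) = chain D l" by (simp add: chD drop_Suc tl_drop)
      have h: "hd (chain D l) = a" using k by (simp add: chD hd_drop_conv_nth)
      show ?thesis by (simp add: cs(2) decode_pops[OF vre] R t h card)
    qed
    have "l = p + card D + (x + k)" using IH(1) p card by simp
    moreover have "accepts n (Pend p (card D) (x + k)) (True # cs)"
      using cs p card by simp
    moreover have "set (chords n (Pend p (card D) (x + k)) (True # cs)) = D"
      using dec R ins unfolding chords_def by auto
    ultimately show ?thesis unfolding p_def by blast
  qed
qed

section \<open>The bijection between accepted sequences and dissections\<close>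

definition size_path :: "nat \<Rightarrow> bool list \<Rightarrow> bool list" where
  "size_path d cs = replicate d False @ True # cs"

lemma accepts_Size_iff:
  "accepts n (Size d) bs \<longleftrightarrow> (\<exists>k cs. bs = size_path k cs \<and> d + k < n \<and> accepts n (Open 2 (d + k) (n - 1 - (d + k))) cs)"
proof (induction bs arbitrary: d)
  case Nil
  then show ?case by (simp add: size_path_def)
next
  case (Cons b bs)
  show ?case
  proof (cases b)
    case True
    have "(\<exists>k cs. b # bs = size_path k cs \<and> d + k < n \<and> accepts n (Open 2 (d + k) (n - 1 - (d + k))) cs)
      \<longleftrightarrow> (d < n \<and> accepts n (Open 2 d (n - 1 - d)) bs)" (is "?l = ?r")
    proof
      assume ?l
      then obtain k cs where "b # bs = size_path k cs" "d + k < n" "accepts n (Open 2 (d + k) (n - 1 - (d + k))) cs"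
        by blast
      with True show ?r by (cases k) (auto simp: size_path_def)
    next
      assume ?r
      then show ?l using True by (intro exI[of _ 0]) (simp add: size_path_def)
    qed
    then show ?thesis using True by simp
  next
    case False
    have "(\<exists>k cs. b # bs = size_path k cs \<and> d + k < n \<and> accepts n (Open 2 (d + k) (n - 1 - (d + k))) cs)
      \<longleftrightarrow> (\<exists>k cs. bs = size_path k cs \<and> Suc d + k < n \<and> accepts n (Open 2 (Suc d + k) (n - 1 - (Suc d + k))) cs)"
      (is "?l = ?r")
    proof
      assume ?l
      then obtain k cs where "b # bs = size_path k cs" "d + k < n" "accepts n (Open 2 (d + k) (n - 1 - (d + k))) cs"
        by blast
      with False show ?r by (cases k) (auto simp: size_path_def)
    next
      assume ?r
      then obtain k cs where "bs = size_path k cs" "Suc d + k < n" "accepts n (Open 2 (Suc d + k) (n - 1 - (Suc d + k))) cs"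
        by blast
      then show ?l using False by (intro exI[of _ "Suc k"]) (auto simp: size_path_def)
    qed
    then show ?thesis using False Cons.IH[of "Suc d"] by auto
  qed
qed

lemma letters_size_path:
  "letters n (Size d) (size_path k cs) = letters n (Open 2 (d + k) (n - 1 - (d + k))) cs"
  by (induction k arbitrary: d) (simp_all add: size_path_def)

lemma Omega_iff:
  "n > 0 \<Longrightarrow> \<sigma> \<in> Omega n \<longleftrightarrow> noncrossing (Suc n) \<sigma> \<and> (0, Suc n) \<notin> \<sigma> \<and> card \<sigma> < n"
  unfolding Omega_def Omega_k_def noncrossing_def diagonals_def
  by (auto intro!: bexI[of _ "Suc (card \<sigma>)"])

lemma accepts_Open_Omega:
  assumes "d < n" "accepts n (Open 2 d (n - 1 - d)) cs"
  defines "e \<equiv> chords n (Open 2 d (n - 1 - d)) cs"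
  shows "set e \<in> Omega n" "distinct e" "length e = d"
proof -
  obtain v r e' where vre: "decode (letters n (Open 2 d (n - 1 - d)) cs) = (v, r, e')" by (metis prod_cases3)
  have e: "e' = e" unfolding e_def chords_def vre by simp
  have "represents (Open 2 d (n - 1 - d)) (v, r, e)"
    using accepts_represents[OF assms(2)] unfolding vre e .
  then obtain j where R: "v = 2 + d + (n - 1 - d)" "noncrossing v (set e)" "distinct e" "length e = d"
    "length r = 2" "r = drop j (chain (set e) v)"
    unfolding represents.simps by blast
  have v: "v = Suc n" using R assms by simp
  have len: "length (chain (set e) v) \<ge> 2" using R(5) unfolding R(6) by simp
  \<comment> \<open>Starting with \<open>p = 2\<close> gives the implicit root two children, whereas
    the chord from \<open>0\<close> to \<open>n + 1\<close> would shorten the outer chain to one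
    vertex.\<close>
  have "(0, Suc n) \<notin> set e"
  proof
    assume "(0, Suc n) \<in> set e"
    then have "outer (set e) v = 0" using outer_least[of 0 "Suc n" "set e"] v by simp
    then show False using len chain_pos[of v "set e"] v by simp
  qed
  then show "set e \<in> Omega n" using R v assms by (subst Omega_iff) (auto simp: distinct_card)
  show "distinct e" "length e = d" using R by auto
qed

lemma accepts_bij_Omega:
  assumes n: "n > 0"
  shows "bij_betw (\<lambda>bs. set (chords n (Size 0) bs)) {bs. accepts n (Size 0) bs} (Omega n)"
proof (rule bij_betwI')
  fix bs bs' assume "bs \<in> {bs. accepts n (Size 0) bs}" "bs' \<in> {bs. accepts n (Size 0) bs}"
  then obtain d cs d' cs' where
    1: "bs = size_path d cs" "d < n" "accepts n (Open 2 d (n - 1 - d)) cs" and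
    2: "bs' = size_path d' cs'" "d' < n" "accepts n (Open 2 d' (n - 1 - d')) cs'"
    using accepts_Size_iff[of n 0] by auto
  have "bs = bs'" if eq: "set (chords n (Size 0) bs) = set (chords n (Size 0) bs')"
  proof -
    have eq': "set (chords n (Open 2 d (n - 1 - d)) cs) = set (chords n (Open 2 d' (n - 1 - d')) cs')"
      using eq 1 2 letters_size_path[of n 0] by (simp add: chords_def)
    then have "d = d'" using accepts_Open_Omega[OF 1(2,3)] accepts_Open_Omega[OF 2(2,3)]
      by (metis distinct_card)
    moreover from this have "cs = cs'" using accepts_inj[of n _ cs cs'] 1 2 eq' by auto
    ultimately show ?thesis using 1 2 by simp
  qed
  then show "(set (chords n (Size 0) bs) = set (chords n (Size 0) bs')) = (bs = bs')" by auto
next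
  fix bs assume "bs \<in> {bs. accepts n (Size 0) bs}"
  then obtain d cs where "bs = size_path d cs" "d < n" "accepts n (Open 2 d (n - 1 - d)) cs"
    using accepts_Size_iff[of n 0] by auto
  then show "set (chords n (Size 0) bs) \<in> Omega n"
    using accepts_Open_Omega(1) letters_size_path[of n 0] by (simp add: chords_def)
next
  fix \<sigma> assume "\<sigma> \<in> Omega n"
  then have \<sigma>: "noncrossing (Suc n) \<sigma>" "(0, Suc n) \<notin> \<sigma>" "card \<sigma> < n" using Omega_iff n by auto
  define a where "a = outer \<sigma> (Suc n)"
  have "a \<noteq> 0"
  proof
    assume "a = 0"
    then show False using outer_cases[of "Suc n" \<sigma>] \<sigma> n by (simp add: a_def)
  qed
  then have "length (chain \<sigma> (Suc n)) \<ge> 2" using chain_pos[of "Suc n" \<sigma>] chain_pos[of a \<sigma>]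
    by (auto simp: a_def)
  then obtain m where m: "length (chain \<sigma> (Suc n)) = 2 + m" by (metis le_iff_add)
  obtain x bs where x: "Suc n = 2 + m + card \<sigma> + x" "accepts n (Pend (2 + m) (card \<sigma>) x) bs"
    "set (chords n (Pend (2 + m) (card \<sigma>) x) bs) = \<sigma>"
    using accepts_exists[OF \<sigma>(1), of n] unfolding m by blast
  define cs where "cs = replicate m True @ False # bs"
  have xm: "x + m = n - 1 - card \<sigma>" using x by simp
  have cs: "accepts n (Open 2 (card \<sigma>) (n - 1 - card \<sigma>)) cs"
    "letters n (Open 2 (card \<sigma>) (n - 1 - card \<sigma>)) cs = replicate m Pop @ letters n (Pend (2 + m) (card \<sigma>) x) bs"
    using accepts_pops[OF x(2)] unfolding cs_def xm by auto
  obtain v r e where "decode (letters n (Pend (2 + m) (card \<sigma>) x) bs) = (v, r, e)" by (metis prod_cases3)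
  then have "set (chords n (Open 2 (card \<sigma>) (n - 1 - card \<sigma>)) cs) = \<sigma>"
    using decode_pops cs(2) x(3) by (simp add: chords_def)
  then have "set (chords n (Size 0) (size_path (card \<sigma>) cs)) = \<sigma>"
    using letters_size_path[of n 0] by (simp add: chords_def)
  moreover have "accepts n (Size 0) (size_path (card \<sigma>) cs)"
    using accepts_Size_iff[of n 0] cs(1) \<sigma>(3) by auto
  ultimately show "\<exists>bs\<in>{bs. accepts n (Size 0) bs}. \<sigma> = set (chords n (Size 0) bs)" by blast
qed

section \<open>Counting the words\<close>

text \<open>
  The cycle lemma suggests \<open>pend_count\<close>: among the arrangements of \<open>l = p + i + x\<close> leaves and \<open>i\<close>
  nodes a fraction \<open>p / (l + i)\<close> is admissible, and the \<open>x\<close> surplus children are distributed over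
  the \<open>i\<close> nodes. Summing over the children added to the open node gives \<open>open_count\<close>. For
  \<open>i = 0\<close> the truncated subtraction makes the binomial coefficient \<open>of_bool (x = 0)\<close>, the correct
  value.
\<close>

definition prefactor :: "nat \<Rightarrow> nat \<Rightarrow> nat \<Rightarrow> real" where
  "prefactor p i x = fact (p + 2 * i + x - 1) / (fact (p + i + x) * fact i)"

definition open_count :: "nat \<Rightarrow> nat \<Rightarrow> nat \<Rightarrow> real" where
  "open_count p i x = prefactor p i x * real ((i + x) choose x) * (real p + real x / (real i + 1))"

definition pend_count :: "nat \<Rightarrow> nat \<Rightarrow> nat \<Rightarrow> real" where
  "pend_count p i x = (if p = 0 then of_bool (i = 0 \<and> x = 0)
     else real p * prefactor p i x * real ((i + x - 1) choose x))"

text \<open>For \<open>d < n\<close> the factor of \<open>lam ^ d\<close> is the Kirkman-Cayley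
  number binom(n - 1, d) * binom(n + d + 1, d) / (d + 1).\<close>

definition size_weight :: "nat \<Rightarrow> real \<Rightarrow> nat \<Rightarrow> real" where
  "size_weight n lam d = lam ^ d * open_count 2 d (n - 1 - d)"

fun total_weight :: "nat \<Rightarrow> real \<Rightarrow> state \<Rightarrow> real" where
  "total_weight n lam (Size d) = (\<Sum>e=d..<n. size_weight n lam e)"
| "total_weight n lam (Open p i x) = open_count p i x"
| "total_weight n lam (Pend p i x) = pend_count p i x"

text \<open>Quotients of total weights after cancelling factorials, with the operations in the order
  in which the program performs them. \<open>Open p 0 0\<close> and \<open>Pend 1 0 0\<close> give
  0/0, and the value 0 of HOL division is the right one, since only \<open>False\<close> is
  available there.\<close>

fun prob_true :: "nat \<Rightarrow> real \<Rightarrow> state \<Rightarrow> real" where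
  "prob_true n lam (Size d) = size_weight n lam d / (\<Sum>e=d..<n. size_weight n lam e)"
| "prob_true n lam (Open p i x) =
     real x * (((real i + 1) * real p + real x) + real i) / ((real i + 1) * real p + real x) / (real i + real x)"
| "prob_true n lam (Pend p i x) =
     (real p * real i + real i + real x) / real p / (real p + real i + real i + real x - 1)"

definition prob_of :: "nat \<Rightarrow> real \<Rightarrow> state \<Rightarrow> bool \<Rightarrow> real" where
  "prob_of n lam s b = (if b then prob_true n lam s else 1 - prob_true n lam s)"

fun factor :: "real \<Rightarrow> state \<Rightarrow> bool \<Rightarrow> real" where
  "factor lam (Size d) b = (if b then lam ^ d else 1)"
| "factor lam s b = 1"

primrec weight :: "nat \<Rightarrow> real \<Rightarrow> state \<Rightarrow> bool list \<Rightarrow> real" where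
  "weight n lam s [] = 1"
| "weight n lam s (b # bs) = factor lam s b * weight n lam (next_state n s b) bs"

section \<open>One-step identities between completion counts\<close>

lemma prefactor_pos: "prefactor p i x > 0"
  by (simp add: prefactor_def)

lemma open_count_pos: "p > 0 \<Longrightarrow> open_count p i x > 0"
  by (simp add: open_count_def prefactor_pos add_pos_nonneg)

lemma size_weight_pos: "lam > 0 \<Longrightarrow> size_weight n lam d > 0"
  by (simp add: size_weight_def open_count_pos)

lemma one_minus_frac:
  fixes a d :: real
  assumes "a \<noteq> 0" "d \<noteq> 0"
  shows "1 - c / a / d = (a * d - c) / (a * d)"
  using assms by (simp add: field_simps)

lemma mult_frac_cancel:
  fixes a :: real
  assumes "a > 0"
  shows "x * c / a / d * (k * b * (a / e)) = x * b / d * c * k / e"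
  using assms by (cases "d = 0"; cases "e = 0") (simp_all add: field_simps)

lemma mult_frac_cancel':
  fixes a :: real
  assumes "a > 0" "e > 0"
  shows "i * p * e / (a * d) * (k * b * (a / e)) = i * b / d * p * k"
  using assms by (cases "d = 0") (simp_all add: field_simps)

lemma mult_frac_cancel'':
  fixes p :: real
  assumes "p \<noteq> 0" "m \<noteq> 0" "q \<noteq> 0"
  shows "s * q / (p * m) * (p * (m * f / (q * g * h)) * b) = s * (f / (g * h)) * b"
  using assms by (cases "g = 0"; cases "h = 0") (simp_all add: field_simps)

text \<open>A \<open>Pop\<close> keeps \<open>p + x\<close> and \<open>i\<close>, and
  \<open>prefactor\<close> depends on nothing else. Only the binomial coefficient and the linear
  factor change.\<close>

lemma open_split_True:
  assumes "p > 0"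
  shows "prob_true n lam (Open p i (Suc x)) * open_count p i (Suc x) = open_count (Suc p) i x"
proof -
  define a X where "a = (real i + 1) * real p + real (Suc x)" and "X = real (Suc x)"
  have "(real i + 1) * real p \<ge> 0" by simp
  then have a: "a > 0" unfolding a_def by linarith
  have K: "prefactor (Suc p) i x = prefactor p i (Suc x)" by (simp add: prefactor_def)
  have "Suc x * ((i + Suc x) choose Suc x) = (i + Suc x) * ((i + x) choose x)"
    using Suc_times_binomial[of x "i + x"] by simp
  then have B: "X * real ((i + Suc x) choose Suc x) = (real i + X) * real ((i + x) choose x)"
    unfolding X_def by (metis of_nat_add of_nat_mult)
  have r1: "real p + X / (real i + 1) = a / (real i + 1)"
    by (simp add: a_def X_def field_simps)
  have r2: "real (Suc p) + real x / (real i + 1) = (a + real i) / (real i + 1)"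
    by (simp add: a_def field_simps)
  have iX: "real i + X > 0" by (simp add: X_def)
  have "prob_true n lam (Open p i (Suc x)) * open_count p i (Suc x) =
    X * (a + real i) / a / (real i + X) * (prefactor p i (Suc x) * real ((i + Suc x) choose Suc x) * (a / (real i + 1)))"
    unfolding prob_true.simps open_count_def r1[symmetric] by (simp add: a_def X_def)
  also have "\<dots> = (X * real ((i + Suc x) choose Suc x)) / (real i + X) * (a + real i) * prefactor p i (Suc x) / (real i + 1)"
    using a by (rule mult_frac_cancel)
  also have "\<dots> = real ((i + x) choose x) * (a + real i) * prefactor p i (Suc x) / (real i + 1)"
    unfolding B using iX by simp
  also have "\<dots> = open_count (Suc p) i x"
    unfolding open_count_def K r2 by simp
  finally show ?thesis .
qed

lemma open_split_False:
  assumes "p > 0"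
  shows "(1 - prob_true n lam (Open p i x)) * open_count p i x = pend_count p i x"
proof (cases "i = 0")
  case True
  then show ?thesis using assms
    by (cases x) (simp_all add: open_count_def pend_count_def divide_simps)
next
  case False
  then obtain j where j: "i = Suc j" by (cases i) auto
  define a where "a = (real i + 1) * real p + real x"
  have "(real i + 1) * real p > 0" using assms by simp
  then have a: "a > 0" unfolding a_def by linarith
  have ix: "real i + real x > 0" using j by simp
  have "Suc j * ((Suc j + x) choose (Suc j)) = (Suc j + x) * ((j + x) choose j)"
    using Suc_times_binomial[of j "j + x"] by simp
  then have "i * ((i + x) choose x) = (i + x) * ((i + x - 1) choose x)"
    using binomial_symmetric[of x "i + x"] binomial_symmetric[of x "j + x"] by (simp add: j)
  then have B: "real i * real ((i + x) choose x) = (real i + real x) * real ((i + x - 1) choose x)"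
    by (metis of_nat_add of_nat_mult)
  have r1: "real p + real x / (real i + 1) = a / (real i + 1)"
    by (simp add: a_def field_simps)
  have "a * (real i + real x) - real x * (a + real i) = real i * real p * (real i + 1)"
    by (simp add: a_def algebra_simps)
  then have q: "1 - real x * (a + real i) / a / (real i + real x) = real i * real p * (real i + 1) / (a * (real i + real x))"
    using one_minus_frac[of a "real i + real x" "real x * (a + real i)"] a ix by simp
  have "(1 - prob_true n lam (Open p i x)) * open_count p i x =
    real i * real p * (real i + 1) / (a * (real i + real x)) * (prefactor p i x * real ((i + x) choose x) * (a / (real i + 1)))"
    unfolding prob_true.simps open_count_def r1[symmetric] q[symmetric] by (simp add: a_def)
  also have "\<dots> = (real i * real ((i + x) choose x)) / (real i + real x) * real p * prefactor p i x"
    using a by (intro mult_frac_cancel') auto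
  also have "\<dots> = real ((i + x - 1) choose x) * real p * prefactor p i x"
    unfolding B using ix by simp
  finally show ?thesis using assms by (simp add: pend_count_def)
qed

lemma pend_split_True:
  assumes "p > 0"
  shows "prob_true n lam (Pend p (Suc j) x) * pend_count p (Suc j) x = open_count (Suc p) j x"
proof -
  define c where "c = real p * real (Suc j) + real (Suc j) + real x"
  define m where "m = p + 2 * j + x"
  have m: "m > 0" using assms by (simp add: m_def)
  have den: "real p + real (Suc j) + real (Suc j) + real x - 1 = real (Suc m)"
    by (simp add: m_def)
  have K1: "prefactor p (Suc j) x = real (Suc m) * fact m / (fact (p + Suc j + x) * (real (Suc j) * fact j))"
    by (simp add: prefactor_def m_def)
  have K2: "prefactor (Suc p) j x = fact m / (fact (p + Suc j + x) * fact j)"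
    by (simp add: prefactor_def m_def)
  have r: "real (Suc p) + real x / (real j + 1) = c / real (Suc j)"
    by (simp add: c_def field_simps)
  have "prob_true n lam (Pend p (Suc j) x) * pend_count p (Suc j) x =
     c / real p / real (Suc m) * (real p * prefactor p (Suc j) x * real ((j + x) choose x))"
    using assms unfolding prob_true.simps den pend_count_def by (simp add: c_def)
  also have "\<dots> = prefactor (Suc p) j x * real ((j + x) choose x) * (c / real (Suc j))"
    unfolding K1 K2 using assms by (simp add: mult_ac)
  finally show ?thesis unfolding open_count_def r .
qed

text \<open>For \<open>x > 0\<close> the probability need not vanish, but the count does: surplus
  children without a node to take them admit no completion.\<close>

lemma pend_split_True_0: "p > 0 \<Longrightarrow> prob_true n lam (Pend p 0 x) * pend_count p 0 x = 0"
  by (cases x) (simp_all add: pend_count_def)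

lemma pend_split_False:
  assumes "p > 0"
  shows "(1 - prob_true n lam (Pend p i x)) * pend_count p i x = pend_count (p - 1) i x"
proof (cases "p = 1")
  case True
  show ?thesis
  proof (cases "i = 0")
    case False
    \<comment> \<open>With one subtree owed and nodes left to place, a \<open>Push\<close> would end
      the word too early, so \<open>Cut\<close> is certain.\<close>
    then have "2 * real i + real x > 0" by simp
    then have "prob_true n lam (Pend p i x) = 1"
      using True by simp
    then show ?thesis using True False by (simp add: pend_count_def)
  next
    case i: True
    then show ?thesis using True
      by (cases x) (simp_all add: pend_count_def prefactor_def)
  qed
next
  case False
  then obtain k where k: "p = Suc (Suc k)" using assms by (cases p; cases "p - 1") auto
  define m where "m = k + 2 * i + x"
  define B where "B = real ((i + x - 1) choose x)"
  have den: "real p + real i + real i + real x - 1 = real (Suc m)"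
    by (simp add: m_def k)
  have K1: "prefactor p i x = real (Suc m) * fact m / (real (p + i + x) * fact (Suc k + i + x) * fact i)"
    by (simp add: prefactor_def m_def k)
  have K2: "prefactor (Suc k) i x = fact m / (fact (Suc k + i + x) * fact i)"
    by (simp add: prefactor_def m_def)
  have "real p * real (Suc m) - (real p * real i + real i + real x) = real (Suc k) * real (p + i + x)"
    by (simp add: m_def k algebra_simps)
  then have q: "1 - prob_true n lam (Pend p i x) = real (Suc k) * real (p + i + x) / (real p * real (Suc m))"
    unfolding prob_true.simps den
    using one_minus_frac[of "real p" "real (Suc m)" "real p * real i + real i + real x"] assms by simp
  have nz: "real (p + i + x) > 0" "real p > 0" "real (Suc m) > 0" using assms by simp_all
  have "(1 - prob_true n lam (Pend p i x)) * pend_count p i x =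
    real (Suc k) * real (p + i + x) / (real p * real (Suc m)) * (real p * prefactor p i x * B)"
    unfolding q using assms by (simp add: pend_count_def B_def)
  also have "\<dots> = real (Suc k) * prefactor (Suc k) i x * B"
    unfolding K1 K2 using nz by (intro mult_frac_cancel'') auto
  finally show ?thesis by (simp add: pend_count_def B_def k)
qed

text \<open>\<open>Open 0 i x\<close> accepts nothing although \<open>open_count 0 i x\<close> is
  positive for \<open>x > 0\<close>. Such states never follow an available decision.\<close>

fun live :: "state \<Rightarrow> bool" where
  "live (Size d) \<longleftrightarrow> True"
| "live (Open p i x) \<longleftrightarrow> p > 0"
| "live (Pend p i x) \<longleftrightarrow> True"

lemma live_next: "available n s b \<Longrightarrow> live (next_state n s b)"
  by (cases s) auto

lemma total_weight_split:
  assumes "lam > 0" "available n s b"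
  shows "prob_of n lam s b * total_weight n lam s = factor lam s b * total_weight n lam (next_state n s b)"
proof (cases s)
  case (Size d)
  then have d: "d < n" using assms by simp
  have "(\<Sum>e=d..<n. size_weight n lam e) > 0"
    using d assms by (intro sum_pos) (auto simp: size_weight_pos)
  moreover have "(\<Sum>e=d..<n. size_weight n lam e) = size_weight n lam d + (\<Sum>e=Suc d..<n. size_weight n lam e)"
    using d by (simp add: sum.atLeast_Suc_lessThan)
  ultimately show ?thesis using Size by (simp add: prob_of_def left_diff_distrib) (simp add: size_weight_def)
next
  case (Open p i x)
  then show ?thesis using assms open_split_True[of p n lam i "x - 1"] open_split_False[of p n lam i x]
    by (cases b) (auto simp: prob_of_def)
next
  case (Pend p i x)
  then show ?thesis using assms pend_split_True[of p n lam "i - 1" x] pend_split_False[of p n lam i x]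
    by (cases b) (auto simp: prob_of_def)
qed

lemma total_weight_unavailable:
  assumes "available n s False" "\<not> available n s True"
  shows "prob_true n lam s * total_weight n lam s = 0"
  using assms pend_split_True_0 by (cases s) auto

lemma prob_of_bounds:
  assumes "lam > 0" "available n s b"
  shows "0 \<le> prob_of n lam s b" "prob_of n lam s b \<le> 1"
proof -
  have "0 \<le> prob_true n lam s \<and> prob_true n lam s \<le> 1"
  proof (cases s)
    case (Size d)
    then have d: "d < n" using assms by simp
    have "(\<Sum>e=d..<n. size_weight n lam e) > 0"
      using d assms by (intro sum_pos) (auto simp: size_weight_pos)
    moreover have "(\<Sum>e=d..<n. size_weight n lam e) = size_weight n lam d + (\<Sum>e=Suc d..<n. size_weight n lam e)"
      using d by (simp add: sum.atLeast_Suc_lessThan)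
    moreover have "(\<Sum>e=Suc d..<n. size_weight n lam e) \<ge> 0"
      using assms by (intro sum_nonneg) (auto intro: less_imp_le size_weight_pos)
    ultimately show ?thesis using Size assms size_weight_pos[of lam n d] by simp
  next
    case (Open p i x)
    then have p: "p > 0" using assms by simp
    have 1: "open_count p i x > 0" using p by (rule open_count_pos)
    have "pend_count p i x \<ge> 0" using prefactor_pos[of p i x] by (simp add: pend_count_def)
    then have "1 - prob_true n lam s \<ge> 0"
      using open_split_False[OF p, of n lam i x] 1 Open by (metis zero_le_mult_iff not_less)
    then show ?thesis using Open by simp
  next
    case (Pend p i x)
    then have p: "p > 0" using assms by simp
    show ?thesis
    proof (cases "p = 1 \<and> i = 0 \<and> x = 0")
      case True
      then show ?thesis using Pend by simp
    next
      case False
      then have "p + 2 * i + x > 1" using p by auto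
      then have "real (p + 2 * i + x) > real 1" by (simp only: of_nat_less_iff)
      then have den: "real p + real i + real i + real x - 1 > 0" by simp
      have "(real p - 1) * (real p + real i + real x) \<ge> 0" using p by simp
      then have "real p * real i + real i + real x \<le> real p * (real p + real i + real i + real x - 1)"
        by (simp add: algebra_simps)
      then show ?thesis using Pend p den by (simp add: divide_simps mult.commute)
    qed
  qed
  then show "0 \<le> prob_of n lam s b" "prob_of n lam s b \<le> 1" by (simp_all add: prob_of_def)
qed

text \<open>A \<open>Pop\<close> turns a surplus child into an owed subtree, so it must be worth
  more than 2; a \<open>Cut\<close> does the same with a node and also reopens the state, so it must
  be worth more than 3. The summand \<open>5 * n\<close> covers the start of the word, and
  \<open>Size 0\<close> gets \<open>6 * n\<close>.\<close>

fun potential :: "nat \<Rightarrow> state \<Rightarrow> nat" where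
  "potential n (Size d) = (n - d) + 5 * n"
| "potential n (Open p i x) = 2 * p + 4 * i + 3 * x + 1"
| "potential n (Pend p i x) = 2 * p + 4 * i + 3 * x"

lemma potential_next: "available n s b \<Longrightarrow> potential n (next_state n s b) < potential n s"
  by (cases s) auto

lemma accepts_length: "accepts n s bs \<Longrightarrow> length bs \<le> potential n s"
proof (induction bs arbitrary: s)
  case (Cons b bs)
  then show ?case using potential_next[of n s b] by fastforce
qed simp

lemma finite_accepts: "finite {bs. accepts n s bs}"
proof (rule finite_subset)
  show "{bs. accepts n s bs} \<subseteq> {bs. set bs \<subseteq> UNIV \<and> length bs \<le> potential n s}"
    using accepts_length by auto
  show "finite {bs::bool list. set bs \<subseteq> UNIV \<and> length bs \<le> potential n s}"
    by (rule finite_lists_length_le) simp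
qed

text \<open>Here the closed forms are confirmed without the cycle lemma: splitting the sum by the
  first decision gives the recursion that \<open>total_weight_split\<close> proves for
  \<open>total_weight\<close>.\<close>

lemma sum_weight:
  assumes "lam > 0" "live s"
  shows "(\<Sum>bs | accepts n s bs. weight n lam s bs) = total_weight n lam s"
  using assms(2)
proof (induction "potential n s" arbitrary: s rule: less_induct)
  case less
  define P where "P b = {bs. available n s b \<and> accepts n (next_state n s b) bs}" for b
  have fin: "finite (P b)" for b
    unfolding P_def by (rule finite_subset[OF _ finite_accepts[of n "next_state n s b"]]) auto
  show ?case
  proof (cases "available n s False")
    case False
    then have no: "\<not> available n s True" by (cases s) auto
    have "{bs. accepts n s bs} = (if s = Pend 0 0 0 then {[]} else {})"
    proof -
      have "accepts n s bs \<longleftrightarrow> bs = [] \<and> s = Pend 0 0 0" for bs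
        using False no by (cases bs) (auto, (metis (full_types))+)
      then show ?thesis by auto
    qed
    moreover have "total_weight n lam s = (if s = Pend 0 0 0 then 1 else 0)"
      using False less.prems by (cases s) (auto simp: pend_count_def)
    ultimately show ?thesis by simp
  next
    case True
    have s: "s \<noteq> Pend 0 0 0" using True by auto
    have eq: "{bs. accepts n s bs} = (#) True ` P True \<union> (#) False ` P False"
    proof (intro set_eqI)
      fix bs show "bs \<in> {bs. accepts n s bs} \<longleftrightarrow> bs \<in> (#) True ` P True \<union> (#) False ` P False"
        using s by (cases bs; cases "hd bs") (auto simp: P_def)
    qed
    have part: "(\<Sum>bs\<in>(#) b ` P b. weight n lam s bs) = prob_of n lam s b * total_weight n lam s" for b
    proof (cases "available n s b")
      case av: True
      have "(\<Sum>bs\<in>(#) b ` P b. weight n lam s bs) = (\<Sum>bs\<in>P b. weight n lam s (b # bs))"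
        by (subst sum.reindex) (auto simp: o_def)
      also have "\<dots> = factor lam s b * (\<Sum>bs | accepts n (next_state n s b) bs. weight n lam (next_state n s b) bs)"
        using av by (simp add: P_def sum_distrib_left)
      also have "\<dots> = factor lam s b * total_weight n lam (next_state n s b)"
        using less.hyps[OF potential_next[OF av] live_next[OF av]] by simp
      finally show ?thesis using total_weight_split[OF assms(1) av] by simp
    next
      case av: False
      then have b using True by (cases b) auto
      then have "prob_of n lam s b * total_weight n lam s = 0"
        using total_weight_unavailable[OF True] av by (simp add: prob_of_def)
      then show ?thesis using av by (simp add: P_def)
    qed
    have "(\<Sum>bs | accepts n s bs. weight n lam s bs) =
      prob_of n lam s True * total_weight n lam s + prob_of n lam s False * total_weight n lam s"
      unfolding eq part[symmetric] by (rule sum.union_disjoint) (auto simp: fin)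
    then show ?thesis by (simp add: prob_of_def algebra_simps)
  qed
qed

lemma weight_not_Size: "(\<forall>d. s \<noteq> Size d) \<Longrightarrow> weight n lam s bs = 1"
proof (induction bs arbitrary: s)
  case (Cons b bs)
  then show ?case by (cases s) auto
qed simp

lemma weight_size_path: "weight n lam (Size d) (size_path k cs) = lam ^ (d + k)"
  by (induction k arbitrary: d) (simp_all add: size_path_def weight_not_Size)

lemma weight_eq_card:
  assumes "accepts n (Size 0) bs"
  shows "weight n lam (Size 0) bs = lam ^ card (set (chords n (Size 0) bs))"
proof -
  obtain d cs where 1: "bs = size_path d cs" "d < n" "accepts n (Open 2 d (n - 1 - d)) cs"
    using accepts_Size_iff[of n 0] assms by auto
  then have "chords n (Size 0) bs = chords n (Open 2 d (n - 1 - d)) cs"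
    using letters_size_path[of n 0] by (simp add: chords_def)
  then show ?thesis using accepts_Open_Omega[OF 1(2,3)] 1(1) weight_size_path[of n lam 0 d cs]
    by (simp add: distinct_card)
qed

lemma total_weight_eq_Z_sum:
  assumes "lam > 0" "n > 0"
  shows "total_weight n lam (Size 0) = Z_sum n lam"
proof -
  have "total_weight n lam (Size 0) = (\<Sum>bs | accepts n (Size 0) bs. lam ^ card (set (chords n (Size 0) bs)))"
    using sum_weight[OF assms(1), of "Size 0" n] by (simp add: weight_eq_card)
  also have "\<dots> = Z_sum n lam"
    unfolding Z_sum_def by (rule sum.reindex_bij_betw[OF accepts_bij_Omega[OF assms(2)]])
  finally show ?thesis .
qed

lemma Z_sum_pos: "lam > 0 \<Longrightarrow> n > 0 \<Longrightarrow> Z_sum n lam > 0"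
  unfolding total_weight_eq_Z_sum[symmetric]
  by (auto intro!: sum_pos simp: size_weight_pos)

section \<open>Recurrence for the size weights\<close>

lemma size_weight_0: "n > 0 \<Longrightarrow> size_weight n lam 0 = 1"
proof -
  assume "n > 0"
  then obtain m where "n = Suc m" by (cases n) auto
  then show ?thesis by (simp add: size_weight_def open_count_def prefactor_def)
qed

text \<open>The program gets each weight from its predecessor in constant time by this quotient of
  consecutive Kirkman-Cayley numbers.\<close>

lemma size_weight_Suc:
  assumes "Suc d < n"
  shows "size_weight n lam (Suc d) = size_weight n lam d * lam * (real n - real (Suc d)) * (real n + real (Suc d) + 1)
    / real (Suc d) / (real (Suc d) + 1)"
proof -
  obtain x where n: "n = Suc (Suc (d + x))" using assms that[of "n - Suc (Suc d)"] by simp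
  define B where "B = real (Suc (d + x) choose x)"
  have b: "Suc x * (Suc (d + x) choose Suc x) = Suc d * (Suc (d + x) choose x)"
  proof -
    have "Suc x * (Suc (d + x) choose Suc x) = Suc (d + x) * ((d + x) choose x)"
      by (rule Suc_times_binomial)
    also have "(d + x) choose x = (d + x) choose d" using binomial_symmetric[of x "d + x"] by simp
    also have "Suc (d + x) * ((d + x) choose d) = Suc d * (Suc (d + x) choose Suc d)"
      by (rule Suc_times_binomial[symmetric])
    also have "Suc (d + x) choose Suc d = Suc (d + x) choose x"
      using binomial_symmetric[of x "Suc (d + x)"] by simp
    finally show ?thesis .
  qed
  then have b': "real (Suc (d + x) choose Suc x) = real (Suc d) * B / real (Suc x)"
    unfolding B_def by (metis nonzero_mult_div_cancel_left of_nat_Suc of_nat_mult of_nat_neq_0)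
  define F :: real where "F = fact (Suc (Suc (d + d + x))) / (fact (n + 1) * fact d)"
  have idx: "n - 1 - d = Suc x" "n - 1 - Suc d = x" by (simp_all add: n)
  have i1: "2 + 2 * d + Suc x - 1 = Suc (Suc (d + d + x))" "2 + d + Suc x = n + 1"
    "2 + 2 * Suc d + x - 1 = Suc (Suc (Suc (d + d + x)))" "2 + Suc d + x = n + 1"
    by (simp_all add: n)
  have F1: "prefactor 2 d (Suc x) = F"
    unfolding prefactor_def F_def i1 ..
  have "real (Suc (Suc (Suc (d + d + x)))) = real n + real (Suc d)" by (simp add: n)
  then have F2: "prefactor 2 (Suc d) x = F * (real n + real (Suc d)) / real (Suc d)"
    unfolding prefactor_def F_def i1 fact_Suc[of d] fact_Suc[of "Suc (Suc (d + d + x))"]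
    by (simp only: times_divide_eq_left times_divide_eq_right divide_divide_eq_left mult_ac of_nat_mult)
  have r1: "real 2 + real (Suc x) / (real d + 1) = (real n + real (Suc d)) / real (Suc d)"
    by (simp add: n field_simps)
  have r2: "real 2 + real x / (real (Suc d) + 1) = (real n + real (Suc d) + 1) / (real (Suc d) + 1)"
    by (simp add: n field_simps)
  have o1: "open_count 2 d (Suc x) = F * (real (Suc d) * B / real (Suc x)) * ((real n + real (Suc d)) / real (Suc d))"
    unfolding open_count_def F1 r1 b'[symmetric] by simp
  have o2: "open_count 2 (Suc d) x = F * (real n + real (Suc d)) / real (Suc d) * B * ((real n + real (Suc d) + 1) / (real (Suc d) + 1))"
    unfolding open_count_def F2 B_def[symmetric] r2 by (simp add: B_def)
  have nx: "real n - real (Suc d) = real (Suc x)" by (simp add: n)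
  show ?thesis unfolding size_weight_def idx o1 o2 nx
    by (simp add: mult_ac)
qed

section \<open>Probability and measurability\<close>

primrec follows :: "nat \<Rightarrow> real \<Rightarrow> state \<Rightarrow> bool list \<Rightarrow> real stream \<Rightarrow> bool" where
  "follows n lam s [] \<omega> \<longleftrightarrow> s = Pend 0 0 0"
| "follows n lam s (b # bs) \<omega> \<longleftrightarrow> available n s b \<and> (b \<longleftrightarrow> shd \<omega> < prob_true n lam s) \<and>
     follows n lam (next_state n s b) bs (stl \<omega>)"

abbreviation uniform01 :: "real measure" where
  "uniform01 \<equiv> uniform_measure lborel {0..1}"

lemma prob_space_uniform01: "prob_space uniform01"
  by (rule prob_space_uniform_measure) simp_all

lemma prob_space_uniform_stream: "prob_space uniform_stream"
  unfolding uniform_stream_def using prob_space_uniform01 by (rule prob_space.prob_space_stream_space)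

lemma space_uniform_stream [simp]: "space uniform_stream = UNIV"
  by (simp add: uniform_stream_def space_stream_space streams_UNIV)

lemma measurable_shd_uniform [measurable]: "shd \<in> borel_measurable uniform_stream"
proof -
  have "shd \<in> measurable uniform_stream uniform01"
    unfolding uniform_stream_def by (rule measurable_shd)
  then show ?thesis by (simp cong: measurable_cong_sets)
qed

lemma measurable_stl_uniform [measurable]: "stl \<in> measurable uniform_stream uniform_stream"
  unfolding uniform_stream_def by measurable

lemma follows_measurable [measurable]: "Measurable.pred uniform_stream (\<lambda>\<omega>. follows n lam s bs \<omega>)"
proof (induction bs arbitrary: s)
  case (Cons b bs)
  have [measurable]: "Measurable.pred uniform_stream (\<lambda>\<omega>. follows n lam (next_state n s b) bs \<omega>)"
    by (rule Cons)
  show ?case unfolding follows.simps by measurable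
next
  case Nil
  have "follows n lam s [] = (\<lambda>_. s = Pend 0 0 0)" by (simp add: fun_eq_iff)
  then show ?case by simp
qed

lemma uniform01_less:
  assumes "0 \<le> q" "q \<le> 1"
  shows "emeasure uniform01 {x. x < q} = ennreal q" "emeasure uniform01 {x. \<not> x < q} = ennreal (1 - q)"
proof -
  have "{0..1} \<inter> {x. x < q} = {0..<q}" using assms by auto
  then show "emeasure uniform01 {x. x < q} = ennreal q"
    using assms divide_ennreal[of q 1] by (simp add: emeasure_uniform_measure)
  have "{0..1} \<inter> {x. \<not> x < q} = {q..1}" using assms by auto
  moreover have "{x. \<not> x < q} \<in> sets lborel" by simp
  ultimately show "emeasure uniform01 {x. \<not> x < q} = ennreal (1 - q)"
    using assms divide_ennreal[of "1 - q" 1] by (simp add: emeasure_uniform_measure)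
qed

text \<open>The first random number is independent of the rest of the stream, so the decision
  probabilities multiply, and by \<open>total_weight_split\<close> the product telescopes. Stating
  it as a product avoids dividing by a total weight.\<close>

lemma emeasure_follows:
  assumes lam: "lam > 0" and "accepts n s bs"
  shows "\<exists>r\<ge>0. emeasure uniform_stream {\<omega>. follows n lam s bs \<omega>} = ennreal r \<and>
    r * total_weight n lam s = weight n lam s bs"
  using assms(2)
proof (induction bs arbitrary: s)
  case Nil
  then show ?case
    using prob_space.emeasure_space_1[OF prob_space_uniform_stream]
    by (intro exI[of _ 1]) (auto simp: pend_count_def)
next
  case (Cons b bs)
  let ?s = "next_state n s b" and ?q = "prob_of n lam s b"
  have av: "available n s b" using Cons.prems by simp
  obtain r where r: "r \<ge> 0" "emeasure uniform_stream {\<omega>. follows n lam ?s bs \<omega>} = ennreal r"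
    "r * total_weight n lam ?s = weight n lam ?s bs"
    using Cons by force
  define X where "X = {x. b \<longleftrightarrow> x < prob_true n lam s}"
  have X: "emeasure uniform01 X = ennreal ?q"
    using uniform01_less[of "prob_true n lam s"] prob_of_bounds[OF lam av]
    by (cases b) (auto simp: X_def prob_of_def)
  have Xs: "X \<in> sets uniform01" by (cases b) (simp_all add: X_def)
  have ms: "{\<omega>. follows n lam s (b # bs) \<omega>} \<in> sets (stream_space uniform01)"
    using follows_measurable[of n lam s "b # bs"]
    unfolding pred_def uniform_stream_def[symmetric] by simp
  have "emeasure uniform_stream {\<omega>. follows n lam s (b # bs) \<omega>} =
     (\<integral>\<^sup>+t. emeasure uniform_stream {\<omega>. follows n lam s (b # bs) (t ## \<omega>)} \<partial>uniform01)"
    using prob_space.emeasure_stream_space[OF prob_space_uniform01 ms]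
    by (simp flip: uniform_stream_def)
  also have "\<dots> = (\<integral>\<^sup>+t. ennreal r * indicator X t \<partial>uniform01)"
  proof (rule nn_integral_cong)
    fix t
    have "{\<omega>. follows n lam s (b # bs) (t ## \<omega>)} = (if t \<in> X then {\<omega>. follows n lam ?s bs \<omega>} else {})"
      using av by (auto simp: X_def)
    then show "emeasure uniform_stream {\<omega>. follows n lam s (b # bs) (t ## \<omega>)} = ennreal r * indicator X t"
      using r by simp
  qed
  also have "\<dots> = ennreal (r * ?q)"
    using Xs X r(1) prob_of_bounds[OF lam av] by (simp add: nn_integral_cmult_indicator ennreal_mult)
  finally have "emeasure uniform_stream {\<omega>. follows n lam s (b # bs) \<omega>} = ennreal (r * ?q)" .
  moreover have "r * ?q * total_weight n lam s = factor lam s b * (r * total_weight n lam ?s)"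
    using total_weight_split[OF lam av] by (simp add: mult_ac)
  ultimately show ?case
    using r prob_of_bounds[OF lam av] by (intro exI[of _ "r * ?q"]) simp
qed

section \<open>Measurability of machine configurations, component by component\<close>

definition measurable_config :: "(real stream \<Rightarrow> config) \<Rightarrow> bool" where
  "measurable_config c \<longleftrightarrow> (\<lambda>\<omega>. pc (c \<omega>)) \<in> measurable uniform_stream (count_space UNIV) \<and>
     (\<forall>k. (\<lambda>\<omega>. reg (c \<omega>) k) \<in> borel_measurable uniform_stream) \<and>
     (\<forall>k. (\<lambda>\<omega>. mem (c \<omega>) k) \<in> borel_measurable uniform_stream) \<and>
     (\<lambda>\<omega>. rnd (c \<omega>)) \<in> measurable uniform_stream uniform_stream"

text \<open>Program counters and addresses take countably many values, so a configuration selected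
  by one of them is treated value by value. This handles the fetched instruction and
  \<open>Store\<close>.\<close>

lemma measurable_config_case:
  assumes "\<And>k::nat. measurable_config (f k)" "g \<in> measurable uniform_stream (count_space UNIV)"
  shows "measurable_config (\<lambda>\<omega>. f (g \<omega>) \<omega>)"
proof -
  have m: "\<And>k. (\<lambda>\<omega>. pc (f k \<omega>)) \<in> measurable uniform_stream (count_space UNIV)"
    "\<And>j k. (\<lambda>\<omega>. reg (f k \<omega>) j) \<in> borel_measurable uniform_stream"
    "\<And>j k. (\<lambda>\<omega>. mem (f k \<omega>) j) \<in> borel_measurable uniform_stream"
    "\<And>k. (\<lambda>\<omega>. rnd (f k \<omega>)) \<in> measurable uniform_stream uniform_stream"
    using assms(1) unfolding measurable_config_def by auto
  show ?thesis
    unfolding measurable_config_def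
    by (intro conjI allI)
      (rule measurable_compose_countable[OF m(1) assms(2)] measurable_compose_countable[OF m(2) assms(2)]
        measurable_compose_countable[OF m(3) assms(2)] measurable_compose_countable[OF m(4) assms(2)])+
qed

lemma measurable_config_if:
  assumes "measurable_config c" "measurable_config d" "Measurable.pred uniform_stream P"
  shows "measurable_config (\<lambda>\<omega>. if P \<omega> then c \<omega> else d \<omega>)"
proof -
  note [measurable] = assms(3)
  have [measurable]: "(\<lambda>\<omega>. pc (c \<omega>)) \<in> measurable uniform_stream (count_space UNIV)"
    "\<And>k. (\<lambda>\<omega>. reg (c \<omega>) k) \<in> borel_measurable uniform_stream"
    "\<And>k. (\<lambda>\<omega>. mem (c \<omega>) k) \<in> borel_measurable uniform_stream"
    "(\<lambda>\<omega>. rnd (c \<omega>)) \<in> measurable uniform_stream uniform_stream"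
    "(\<lambda>\<omega>. pc (d \<omega>)) \<in> measurable uniform_stream (count_space UNIV)"
    "\<And>k. (\<lambda>\<omega>. reg (d \<omega>) k) \<in> borel_measurable uniform_stream"
    "\<And>k. (\<lambda>\<omega>. mem (d \<omega>) k) \<in> borel_measurable uniform_stream"
    "(\<lambda>\<omega>. rnd (d \<omega>)) \<in> measurable uniform_stream uniform_stream"
    using assms(1,2) unfolding measurable_config_def by auto
  show ?thesis
    unfolding measurable_config_def
      if_distrib[of pc] if_distrib[of reg] if_distrib[of mem] if_distrib[of rnd] if_distribR
    by (intro conjI allI) measurable
qed

lemma measurable_config_set_reg:
  assumes "measurable_config c" "f \<in> borel_measurable uniform_stream"
  shows "measurable_config (\<lambda>\<omega>. set_reg a (f \<omega>) (c \<omega>))"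
proof -
  have "(\<lambda>\<omega>. ((reg (c \<omega>))(a := f \<omega>)) k) \<in> borel_measurable uniform_stream" for k
    using assms by (cases "k = a") (auto simp: measurable_config_def)
  then show ?thesis using assms unfolding measurable_config_def by auto
qed

lemma Nats_borel [measurable]: "(\<nat> :: real set) \<in> sets borel"
  unfolding Nats_def by (rule sets.countable) auto

lemma measurable_config_exec:
  assumes c: "measurable_config c"
  shows "measurable_config (\<lambda>\<omega>. exec i (c \<omega>))"
proof -
  have [measurable]: "(\<lambda>\<omega>. pc (c \<omega>)) \<in> measurable uniform_stream (count_space UNIV)"
    "\<And>k. (\<lambda>\<omega>. reg (c \<omega>) k) \<in> borel_measurable uniform_stream"
    "\<And>k. (\<lambda>\<omega>. mem (c \<omega>) k) \<in> borel_measurable uniform_stream"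
    "(\<lambda>\<omega>. rnd (c \<omega>)) \<in> measurable uniform_stream uniform_stream"
    using c unfolding measurable_config_def by auto
  have addr [measurable]: "(\<lambda>\<omega>. nat \<lfloor>reg (c \<omega>) b\<rfloor>) \<in> measurable uniform_stream (count_space UNIV)" for b
    by measurable
  show ?thesis
  proof (cases i)
    case (Arith f a b d)
    have "(\<lambda>\<omega>. arith f (reg (c \<omega>) b) (reg (c \<omega>) d)) \<in> borel_measurable uniform_stream"
      by (cases f) simp_all
    then show ?thesis using Arith c by (simp add: measurable_config_set_reg)
  next
    case (Load a b)
    have "(\<lambda>\<omega>. mem (c \<omega>) (nat \<lfloor>reg (c \<omega>) b\<rfloor>)) \<in> borel_measurable uniform_stream"
      by (rule measurable_compose_countable[OF _ addr]) simp
    then show ?thesis using Load c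
      by (auto intro!: measurable_config_if measurable_config_set_reg)
  next
    case (Store a b)
    have "measurable_config (\<lambda>\<omega>. c \<omega>\<lparr>pc := Suc (pc (c \<omega>)), mem := (mem (c \<omega>))(k := reg (c \<omega>) b)\<rparr>)" for k
      unfolding measurable_config_def by (auto simp: fun_upd_def)
    from measurable_config_case[OF this addr[of a]] show ?thesis
      using Store c by (auto intro!: measurable_config_if)
  next
    case (Draw a)
    then show ?thesis
      unfolding measurable_config_def by (auto simp: fun_upd_def)
  next
    case (Jump l)
    then show ?thesis unfolding measurable_config_def by auto
  next
    case (JumpLess a b l)
    then show ?thesis unfolding measurable_config_def by auto
  qed (use c in \<open>auto intro!: measurable_config_set_reg\<close>)
qed

lemma run_Suc: "run P n lam \<omega> (Suc t) = step P (run P n lam \<omega> t)"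
  by (simp add: run_def)

lemma measurable_config_run: "measurable_config (\<lambda>\<omega>. run P n lam \<omega> t)"
proof (induction t)
  case 0
  then show ?case by (simp add: run_def init_def measurable_config_def)
next
  case (Suc t)
  define f where "f k \<omega> = (if k \<ge> length P then run P n lam \<omega> t else exec (P ! k) (run P n lam \<omega> t))" for k \<omega>
  have "measurable_config (f k)" for k
    using Suc measurable_config_exec[OF Suc] unfolding f_def by (cases "k \<ge> length P") auto
  then have "measurable_config (\<lambda>\<omega>. f (pc (run P n lam \<omega> t)) \<omega>)"
    by (rule measurable_config_case) (use Suc in \<open>simp add: measurable_config_def\<close>)
  then show ?case by (simp add: f_def run_Suc step_def halted_def)
qed

lemma halted_measurable [measurable]: "Measurable.pred uniform_stream (\<lambda>\<omega>. halted P (run P n lam \<omega> t))"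
proof -
  have [measurable]: "(\<lambda>\<omega>. pc (run P n lam \<omega> t)) \<in> measurable uniform_stream (count_space UNIV)"
    using measurable_config_run by (simp add: measurable_config_def)
  show ?thesis unfolding halted_def by measurable
qed

lemma encodes_measurable: "Measurable.pred uniform_stream (\<lambda>\<omega>. encodes (run P n lam \<omega> t) \<sigma>)"
proof -
  have [measurable]: "\<And>k. (\<lambda>\<omega>. reg (run P n lam \<omega> t) k) \<in> borel_measurable uniform_stream"
    "\<And>k. (\<lambda>\<omega>. mem (run P n lam \<omega> t) k) \<in> borel_measurable uniform_stream"
    using measurable_config_run by (simp_all add: measurable_config_def)
  show ?thesis unfolding encodes_def by measurable
qed

lemma outputs_measurable: "{\<omega>. outputs P n lam \<omega> \<sigma>} \<in> sets uniform_stream"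
proof -
  note encodes_measurable [measurable]
  have "Measurable.pred uniform_stream (\<lambda>\<omega>. outputs P n lam \<omega> \<sigma>)"
    unfolding outputs_def by measurable
  then show ?thesis by (simp add: pred_def)
qed

lemma run_time_measurable: "run_time P n lam \<in> borel_measurable uniform_stream"
proof -
  \<comment> \<open>The index set of the infimum depends on the stream; the default
    \<open>top\<close> replaces it by a fixed countable one.\<close>
  have "run_time P n lam = (\<lambda>\<omega>. INF t. if halted P (run P n lam \<omega> t) then of_nat t else top)"
  proof
    fix \<omega>
    have "(INF t\<in>{t. Q t}. of_nat t) = (INF t. if Q t then of_nat t else (top::ennreal))" for Q :: "nat \<Rightarrow> bool"
    proof (rule antisym)
      show "(INF t\<in>{t. Q t}. of_nat t) \<le> (INF t. if Q t then of_nat t else (top::ennreal))"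
        by (rule INF_greatest) (auto intro: INF_lower)
      show "(INF t. if Q t then of_nat t else (top::ennreal)) \<le> (INF t\<in>{t. Q t}. of_nat t)"
      proof (rule INF_greatest)
        fix t assume "t \<in> {t. Q t}"
        then show "(INF t. if Q t then of_nat t else (top::ennreal)) \<le> of_nat t"
          using INF_lower[of t UNIV "\<lambda>t. if Q t then of_nat t else (top::ennreal)"] by simp
      qed
    qed
    then show "run_time P n lam \<omega> = (INF t. if halted P (run P n lam \<omega> t) then of_nat t else top)"
      unfolding run_time_def .
  qed
  moreover have "(\<lambda>\<omega>. INF t. if halted P (run P n lam \<omega> t) then of_nat t else (top::ennreal)) \<in> borel_measurable uniform_stream"
    by measurable
  ultimately show ?thesis by simp
qed

lemma run_halted:
  assumes "halted P (run P n lam \<omega> t)" "t \<le> t'"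
  shows "run P n lam \<omega> t' = run P n lam \<omega> t"
  using assms(2)
proof (induction t' rule: dec_induct)
  case (step m)
  then show ?case using assms(1) by (simp add: run_Suc) (simp add: step_def)
qed simp

lemma encodes_unique: "encodes c \<sigma> \<Longrightarrow> encodes c \<tau> \<Longrightarrow> \<sigma> = \<tau>"
proof -
  assume "encodes c \<sigma>" "encodes c \<tau>"
  then obtain ds es where
    ds: "set ds = \<sigma>" "reg c 0 = real (length ds)"
    "\<forall>t<length ds. mem c (2 * t) = real (fst (ds ! t)) \<and> mem c (2 * t + 1) = real (snd (ds ! t))" and
    es: "set es = \<tau>" "reg c 0 = real (length es)"
    "\<forall>t<length es. mem c (2 * t) = real (fst (es ! t)) \<and> mem c (2 * t + 1) = real (snd (es ! t))"
    unfolding encodes_def by blast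
  have "ds = es"
  proof (rule nth_equalityI)
    show len: "length ds = length es" using ds es by simp
    fix t assume "t < length ds"
    then have "real (fst (ds ! t)) = real (fst (es ! t))" "real (snd (ds ! t)) = real (snd (es ! t))"
      using ds(3) es(3) len by metis+
    then show "ds ! t = es ! t" by (simp add: prod_eq_iff)
  qed
  then show ?thesis using ds es by simp
qed

lemma outputs_unique: "outputs P n lam \<omega> \<sigma> \<Longrightarrow> outputs P n lam \<omega> \<tau> \<Longrightarrow> \<sigma> = \<tau>"
  unfolding outputs_def by (metis encodes_unique linear run_halted)

section \<open>The program\<close>

text \<open>
  Registers: 3 number of diagonals, 4 current weight, 5 total of the remaining weights,
  7, 8, 9 the parameters of the state, 10 the address behind the last letter, 14 current vertex,
  15 stack pointer, 16 output pointer, 18 start of the word; 2 and 20 hold the constants 1 and 0.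
  The output occupies the cells below \<open>2n\<close>, the word starts at \<open>2n\<close> and the stack starts where
  the word ends.
\<close>

definition sampler :: "instr list" where
  "sampler =
    [Const 2 1, Const 4 1,
     \<comment> \<open>2: register 5 accumulates the weights of all sizes\<close>
     Arith Plus 5 5 4, Arith Plus 3 3 2, Arith Times 4 4 1, Arith Minus 6 0 3, Arith Times 4 4 6,
     Arith Plus 6 0 3, Arith Plus 6 6 2, Arith Times 4 4 6, Arith Divide 4 4 3, Arith Plus 6 3 2,
     Arith Divide 4 4 6, JumpLess 3 0 2,
     Const 3 0, Const 4 1,
     \<comment> \<open>16: decision at \<open>Size\<close>\<close>
     Draw 11, Arith Divide 12 4 5, JumpLess 11 12 31, Arith Minus 5 5 4,
     Arith Plus 3 3 2, Arith Times 4 4 1, Arith Minus 6 0 3, Arith Times 4 4 6,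
     Arith Plus 6 0 3, Arith Plus 6 6 2, Arith Times 4 4 6, Arith Divide 4 4 3, Arith Plus 6 3 2,
     Arith Divide 4 4 6, Jump 16,
     Const 7 2, Move 8 3, Arith Minus 9 0 2, Arith Minus 9 9 3, Arith Plus 10 0 0,
     \<comment> \<open>36: decision at \<open>Open\<close>\<close>
     Draw 11, Arith Plus 12 8 2, Arith Times 12 12 7, Arith Plus 12 12 9, Arith Plus 13 12 8,
     Arith Times 13 9 13, Arith Divide 13 13 12, Arith Plus 12 8 9, Arith Divide 13 13 12,
     JumpLess 11 13 62,
     \<comment> \<open>46: decision at \<open>Pend\<close>\<close>
     Draw 11, Arith Times 12 7 8, Arith Plus 12 12 8, Arith Plus 12 12 9, Arith Divide 12 12 7,
     Arith Plus 13 7 8, Arith Plus 13 13 8, Arith Plus 13 13 9, Arith Minus 13 13 2,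
     Arith Divide 12 12 13, JumpLess 11 12 65,
     Store 10 20, Arith Plus 10 10 2, Arith Minus 7 7 2, JumpLess 20 7 46, Jump 71,
     Store 10 2, Arith Minus 9 9 2, Jump 68,
     Const 12 2, Store 10 12, Arith Minus 8 8 2, Arith Plus 10 10 2, Arith Plus 7 7 2, Jump 36,
     \<comment> \<open>71: decoding of the word from its end\<close>
     Arith Plus 18 0 0, Move 15 10, JumpLess 18 10 75, Jump 92,
     Arith Minus 10 10 2, Load 12 10, JumpLess 20 12 82,
     Store 15 14, Arith Plus 15 15 2, Arith Plus 14 14 2, Jump 73,
     Arith Minus 15 15 2, JumpLess 2 12 85, Jump 73,
     Arith Minus 12 15 2, Load 12 12, Store 16 12, Arith Plus 16 16 2, Store 16 14,
     Arith Plus 16 16 2, Jump 73,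
     Move 0 3]"

definition steps :: "nat \<Rightarrow> config \<Rightarrow> config" where
  "steps k c = (step sampler ^^ k) c"

lemma steps_add: "steps k (steps j c) = steps (j + k) c"
  by (subst add.commute) (simp add: steps_def funpow_add)

lemma steps_0: "steps 0 c = c"
  by (simp add: steps_def)

lemma steps_1: "steps (Suc 0) c = step sampler c" "steps 1 c = step sampler c"
  by (simp_all add: steps_def)

lemma steps_numeral: "steps (numeral k) c = steps (pred_numeral k) (step sampler c)"
  by (simp add: steps_def numeral_eq_Suc funpow_swap1)

lemma length_sampler: "length sampler = 93"
  by (simp add: sampler_def)

lemma step_sampler: "step sampler c = (if pc c \<ge> 93 then c else exec (sampler ! pc c) c)"
  by (simp add: step_def halted_def length_sampler)

lemma sampler_nth:
  "sampler ! 0 = Const 2 1" "sampler ! Suc 0 = Const 4 1"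
  "sampler ! 2 = Arith Plus 5 5 4" "sampler ! 3 = Arith Plus 3 3 2" "sampler ! 4 = Arith Times 4 4 1"
  "sampler ! 5 = Arith Minus 6 0 3" "sampler ! 6 = Arith Times 4 4 6" "sampler ! 7 = Arith Plus 6 0 3"
  "sampler ! 8 = Arith Plus 6 6 2" "sampler ! 9 = Arith Times 4 4 6" "sampler ! 10 = Arith Divide 4 4 3"
  "sampler ! 11 = Arith Plus 6 3 2" "sampler ! 12 = Arith Divide 4 4 6" "sampler ! 13 = JumpLess 3 0 2"
  "sampler ! 14 = Const 3 0" "sampler ! 15 = Const 4 1"
  "sampler ! 16 = Draw 11" "sampler ! 17 = Arith Divide 12 4 5" "sampler ! 18 = JumpLess 11 12 31"
  "sampler ! 19 = Arith Minus 5 5 4" "sampler ! 20 = Arith Plus 3 3 2" "sampler ! 21 = Arith Times 4 4 1"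
  "sampler ! 22 = Arith Minus 6 0 3" "sampler ! 23 = Arith Times 4 4 6" "sampler ! 24 = Arith Plus 6 0 3"
  "sampler ! 25 = Arith Plus 6 6 2" "sampler ! 26 = Arith Times 4 4 6" "sampler ! 27 = Arith Divide 4 4 3"
  "sampler ! 28 = Arith Plus 6 3 2" "sampler ! 29 = Arith Divide 4 4 6" "sampler ! 30 = Jump 16"
  "sampler ! 31 = Const 7 2" "sampler ! 32 = Move 8 3" "sampler ! 33 = Arith Minus 9 0 2"
  "sampler ! 34 = Arith Minus 9 9 3" "sampler ! 35 = Arith Plus 10 0 0"
  "sampler ! 36 = Draw 11" "sampler ! 37 = Arith Plus 12 8 2" "sampler ! 38 = Arith Times 12 12 7"
  "sampler ! 39 = Arith Plus 12 12 9" "sampler ! 40 = Arith Plus 13 12 8" "sampler ! 41 = Arith Times 13 9 13"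
  "sampler ! 42 = Arith Divide 13 13 12" "sampler ! 43 = Arith Plus 12 8 9" "sampler ! 44 = Arith Divide 13 13 12"
  "sampler ! 45 = JumpLess 11 13 62"
  "sampler ! 46 = Draw 11" "sampler ! 47 = Arith Times 12 7 8" "sampler ! 48 = Arith Plus 12 12 8"
  "sampler ! 49 = Arith Plus 12 12 9" "sampler ! 50 = Arith Divide 12 12 7" "sampler ! 51 = Arith Plus 13 7 8"
  "sampler ! 52 = Arith Plus 13 13 8" "sampler ! 53 = Arith Plus 13 13 9" "sampler ! 54 = Arith Minus 13 13 2"
  "sampler ! 55 = Arith Divide 12 12 13" "sampler ! 56 = JumpLess 11 12 65"
  "sampler ! 57 = Store 10 20" "sampler ! 58 = Arith Plus 10 10 2" "sampler ! 59 = Arith Minus 7 7 2"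
  "sampler ! 60 = JumpLess 20 7 46" "sampler ! 61 = Jump 71"
  "sampler ! 62 = Store 10 2" "sampler ! 63 = Arith Minus 9 9 2" "sampler ! 64 = Jump 68"
  "sampler ! 65 = Const 12 2" "sampler ! 66 = Store 10 12" "sampler ! 67 = Arith Minus 8 8 2"
  "sampler ! 68 = Arith Plus 10 10 2" "sampler ! 69 = Arith Plus 7 7 2" "sampler ! 70 = Jump 36"
  "sampler ! 71 = Arith Plus 18 0 0" "sampler ! 72 = Move 15 10" "sampler ! 73 = JumpLess 18 10 75"
  "sampler ! 74 = Jump 92" "sampler ! 75 = Arith Minus 10 10 2" "sampler ! 76 = Load 12 10"
  "sampler ! 77 = JumpLess 20 12 82" "sampler ! 78 = Store 15 14" "sampler ! 79 = Arith Plus 15 15 2"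
  "sampler ! 80 = Arith Plus 14 14 2" "sampler ! 81 = Jump 73" "sampler ! 82 = Arith Minus 15 15 2"
  "sampler ! 83 = JumpLess 2 12 85" "sampler ! 84 = Jump 73" "sampler ! 85 = Arith Minus 12 15 2"
  "sampler ! 86 = Load 12 12" "sampler ! 87 = Store 16 12" "sampler ! 88 = Arith Plus 16 16 2"
  "sampler ! 89 = Store 16 14" "sampler ! 90 = Arith Plus 16 16 2" "sampler ! 91 = Jump 73"
  "sampler ! 92 = Move 0 3"
  by (simp_all add: sampler_def)

lemmas run_simps = steps_0 steps_1 steps_numeral step_sampler sampler_nth

section \<open>Effect of the straight-line blocks\<close>

lemma block_init: "pc c = 0 \<Longrightarrow> steps 2 c = c\<lparr>pc := 2, reg := (reg c)(2 := 1, 4 := 1)\<rparr>"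
  by (simp add: run_simps)

lemma block_sum:
  "pc c = 2 \<Longrightarrow> steps 12 c = c\<lparr>pc := if reg c 3 + reg c 2 < reg c 0 then 2 else 14,
     reg := (reg c)(5 := reg c 5 + reg c 4, 3 := reg c 3 + reg c 2,
       4 := reg c 4 * reg c 1 * (reg c 0 - (reg c 3 + reg c 2)) * (reg c 0 + (reg c 3 + reg c 2) + reg c 2)
         / (reg c 3 + reg c 2) / (reg c 3 + reg c 2 + reg c 2),
       6 := reg c 3 + reg c 2 + reg c 2)\<rparr>"
  by (simp add: run_simps fun_upd_twist)

lemma block_reset: "pc c = 14 \<Longrightarrow> steps 2 c = c\<lparr>pc := 16, reg := (reg c)(3 := 0, 4 := 1)\<rparr>"
  by (simp add: run_simps)

lemma block_size:
  "pc c = 16 \<Longrightarrow> steps 3 c = c\<lparr>pc := if shd (rnd c) < reg c 4 / reg c 5 then 31 else 19,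
     reg := (reg c)(11 := shd (rnd c), 12 := reg c 4 / reg c 5), rnd := stl (rnd c)\<rparr>"
  by (simp add: run_simps)

lemma block_size_Suc:
  "pc c = 19 \<Longrightarrow> steps 12 c = c\<lparr>pc := 16,
     reg := (reg c)(5 := reg c 5 - reg c 4, 3 := reg c 3 + reg c 2,
       4 := reg c 4 * reg c 1 * (reg c 0 - (reg c 3 + reg c 2)) * (reg c 0 + (reg c 3 + reg c 2) + reg c 2)
         / (reg c 3 + reg c 2) / (reg c 3 + reg c 2 + reg c 2),
       6 := reg c 3 + reg c 2 + reg c 2)\<rparr>"
  by (simp add: run_simps fun_upd_twist)

lemma block_size_chosen:
  "pc c = 31 \<Longrightarrow> steps 5 c = c\<lparr>pc := 36,
     reg := (reg c)(7 := 2, 8 := reg c 3, 9 := reg c 0 - reg c 2 - reg c 3, 10 := reg c 0 + reg c 0)\<rparr>"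
  by (simp add: run_simps)

lemma block_open:
  "pc c = 36 \<Longrightarrow> steps 10 c = c\<lparr>
     pc := if shd (rnd c) < reg c 9 * (((reg c 8 + reg c 2) * reg c 7 + reg c 9) + reg c 8)
       / ((reg c 8 + reg c 2) * reg c 7 + reg c 9) / (reg c 8 + reg c 9) then 62 else 46,
     reg := (reg c)(11 := shd (rnd c), 12 := reg c 8 + reg c 9,
       13 := reg c 9 * (((reg c 8 + reg c 2) * reg c 7 + reg c 9) + reg c 8)
         / ((reg c 8 + reg c 2) * reg c 7 + reg c 9) / (reg c 8 + reg c 9)),
     rnd := stl (rnd c)\<rparr>"
  by (simp add: run_simps fun_upd_twist)

lemma block_pop:
  "pc c = 62 \<Longrightarrow> reg c 10 = real m \<Longrightarrow> steps 6 c = c\<lparr>pc := 36,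
     reg := (reg c)(9 := reg c 9 - reg c 2, 10 := real m + reg c 2, 7 := reg c 7 + reg c 2),
     mem := (mem c)(m := reg c 2)\<rparr>"
  by (simp add: run_simps fun_upd_twist)

lemma block_pend:
  "pc c = 46 \<Longrightarrow> steps 11 c = c\<lparr>
     pc := if shd (rnd c) < (reg c 7 * reg c 8 + reg c 8 + reg c 9) / reg c 7
       / (reg c 7 + reg c 8 + reg c 8 + reg c 9 - reg c 2) then 65 else 57,
     reg := (reg c)(11 := shd (rnd c), 13 := reg c 7 + reg c 8 + reg c 8 + reg c 9 - reg c 2,
       12 := (reg c 7 * reg c 8 + reg c 8 + reg c 9) / reg c 7
         / (reg c 7 + reg c 8 + reg c 8 + reg c 9 - reg c 2)),
     rnd := stl (rnd c)\<rparr>"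
  by (simp add: run_simps fun_upd_twist)

lemma block_push:
  "pc c = 57 \<Longrightarrow> reg c 10 = real m \<Longrightarrow> steps 4 c = c\<lparr>
     pc := if reg c 20 < reg c 7 - reg c 2 then 46 else 61,
     reg := (reg c)(10 := real m + reg c 2, 7 := reg c 7 - reg c 2),
     mem := (mem c)(m := reg c 20)\<rparr>"
  by (simp add: run_simps fun_upd_twist)

lemma block_cut:
  "pc c = 65 \<Longrightarrow> reg c 10 = real m \<Longrightarrow> steps 6 c = c\<lparr>pc := 36,
     reg := (reg c)(12 := 2, 8 := reg c 8 - reg c 2, 10 := real m + reg c 2, 7 := reg c 7 + reg c 2),
     mem := (mem c)(m := 2)\<rparr>"
  by (simp add: run_simps fun_upd_twist)

lemma block_decode:
  "pc c = 61 \<Longrightarrow> steps 3 c = c\<lparr>pc := 73, reg := (reg c)(18 := reg c 0 + reg c 0, 15 := reg c 10)\<rparr>"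
  by (simp add: run_simps fun_upd_twist)

lemma block_load:
  "pc c = 73 \<Longrightarrow> reg c 18 < reg c 10 \<Longrightarrow> reg c 10 - reg c 2 = real m \<Longrightarrow> steps 4 c = c\<lparr>
     pc := if reg c 20 < mem c m then 82 else 78, reg := (reg c)(10 := real m, 12 := mem c m)\<rparr>"
  by (simp add: run_simps fun_upd_twist)

lemma block_exit:
  "pc c = 73 \<Longrightarrow> \<not> reg c 18 < reg c 10 \<Longrightarrow> steps 3 c = c\<lparr>pc := 93, reg := (reg c)(0 := reg c 3)\<rparr>"
  by (simp add: run_simps)

lemma block_act_push:
  "pc c = 78 \<Longrightarrow> reg c 15 = real m \<Longrightarrow> steps 4 c = c\<lparr>pc := 73,
     reg := (reg c)(15 := real m + reg c 2, 14 := reg c 14 + reg c 2),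
     mem := (mem c)(m := reg c 14)\<rparr>"
  by (simp add: run_simps fun_upd_twist)

lemma block_act_pop:
  "pc c = 82 \<Longrightarrow> \<not> reg c 2 < reg c 12 \<Longrightarrow> steps 3 c = c\<lparr>pc := 73, reg := (reg c)(15 := reg c 15 - reg c 2)\<rparr>"
  by (simp add: run_simps)

lemma block_act_cut:
  "pc c = 82 \<Longrightarrow> reg c 2 < reg c 12 \<Longrightarrow> reg c 15 - reg c 2 - reg c 2 = real m \<Longrightarrow> reg c 16 = real k \<Longrightarrow>
   reg c 2 = 1 \<Longrightarrow> steps 9 c = c\<lparr>pc := 73,
     reg := (reg c)(15 := reg c 15 - 1, 12 := mem c m, 16 := real (Suc (Suc k))),
     mem := (mem c)(k := mem c m, Suc k := reg c 14)\<rparr>"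
proof -
  assume *: "pc c = 82" "reg c 2 < reg c 12" "reg c 15 - reg c 2 - reg c 2 = real m" "reg c 16 = real k" "reg c 2 = 1"
  \<comment> \<open>\<open>Store\<close> proceeds only at addresses in the naturals, so the
    incremented output pointer has to be recognised as one.\<close>
  have "real k + 1 = real (Suc k)" by simp
  then have n: "real k + 1 \<in> \<nat>" by (metis of_nat_in_Nats)
  have r: "reg c 15 - 1 - 1 = real m" using *(3,5) by simp
  have f: "nat \<lfloor>real k + 1\<rfloor> = Suc k" by linarith
  show ?thesis using *(1,2,4,5) n r f
    by (simp add: run_simps fun_upd_twist)
qed

section \<open>The random phase\<close>

lemma size_weight_Suc':
  "Suc d < n \<Longrightarrow> size_weight n lam (Suc d) = size_weight n lam d * lam * (real n - (real d + 1))
     * (real n + (real d + 1) + 1) / (real d + 1) / (real d + 1 + 1)"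
  by (simp add: size_weight_Suc add_ac)

fun code :: "letter \<Rightarrow> real" where
  "code Push = 0"
| "code Pop = 1"
| "code Cut = 2"

definition base :: "nat \<Rightarrow> real \<Rightarrow> config \<Rightarrow> bool" where
  "base n lam c \<longleftrightarrow> reg c 0 = real n \<and> reg c 1 = lam \<and> reg c 2 = 1 \<and> reg c 14 = 0 \<and> reg c 16 = 0 \<and> reg c 20 = 0"

definition written :: "nat \<Rightarrow> letter list \<Rightarrow> config \<Rightarrow> bool" where
  "written n u c \<longleftrightarrow> reg c 10 = real (2 * n + length u) \<and> (\<forall>j<length u. mem c (2 * n + j) = code (u ! j))"

lemma written_snoc:
  assumes "written n u c" "reg c' 10 = real (2 * n + length u) + 1" "mem c' = (mem c)(2 * n + length u := code a)"
  shows "written n (u @ [a]) c'"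
  using assms by (auto simp: written_def nth_append less_Suc_eq)

text \<open>Register 3 keeps the number of diagonals, which is the nodes still to place plus the
  \<open>Cut\<close>s already written; it becomes the output length. The case \<open>p = 0\<close>
  of \<open>Pend\<close> is the exit of the \<open>Push\<close> block.\<close>

fun at_state :: "nat \<Rightarrow> real \<Rightarrow> state \<Rightarrow> letter list \<Rightarrow> config \<Rightarrow> bool" where
  "at_state n lam (Size d) u c \<longleftrightarrow> base n lam c \<and> u = [] \<and> pc c = 16 \<and> reg c 3 = real d \<and>
     reg c 4 = size_weight n lam d \<and> reg c 5 = (\<Sum>e=d..<n. size_weight n lam e)"
| "at_state n lam (Open p i x) u c \<longleftrightarrow> base n lam c \<and> written n u c \<and> pc c = 36 \<and>
     reg c 3 = real (i + count_list u Cut) \<and> reg c 7 = real p \<and> reg c 8 = real i \<and> reg c 9 = real x"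
| "at_state n lam (Pend p i x) u c \<longleftrightarrow> base n lam c \<and> written n u c \<and> pc c = (if p = 0 then 61 else 46) \<and>
     reg c 3 = real (i + count_list u Cut) \<and> reg c 7 = real p \<and> reg c 8 = real i \<and> reg c 9 = real x"

text \<open>\<open>nxt\<close> rules out stepping past the last size, where the weight recurrence
  stops; a followed sequence can neither end nor continue in \<open>Size d\<close> with
  \<open>d >= n\<close>. The longest decision takes 11 + 6 instructions.\<close>

lemma decision:
  assumes st: "at_state n lam s u c" and av: "available n s b" and b: "b \<longleftrightarrow> shd (rnd c) < prob_true n lam s"
    and nxt: "\<And>d. next_state n s b = Size d \<Longrightarrow> d < n"
  shows "\<exists>k\<le>20. at_state n lam (next_state n s b) (u @ emitted s b) (steps k c) \<and> rnd (steps k c) = stl (rnd c)"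
proof (cases s)
  case (Size d)
  have c: "base n lam c" "u = []" "pc c = 16" "reg c 3 = real d"
    "reg c 4 = size_weight n lam d" "reg c 5 = (\<Sum>e=d..<n. size_weight n lam e)"
    using st Size by auto
  define c1 where "c1 = steps 3 c"
  have c1: "c1 = c\<lparr>pc := if b then 31 else 19,
     reg := (reg c)(11 := shd (rnd c), 12 := reg c 4 / reg c 5), rnd := stl (rnd c)\<rparr>"
    unfolding c1_def block_size[OF c(3)] using b c Size by simp
  show ?thesis
  proof (cases b)
    case True
    have "steps 5 c1 = c1\<lparr>pc := 36,
     reg := (reg c1)(7 := 2, 8 := reg c1 3, 9 := reg c1 0 - reg c1 2 - reg c1 3, 10 := reg c1 0 + reg c1 0)\<rparr>"
      by (rule block_size_chosen) (simp add: c1 True)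
    moreover have "d < n" using av Size by simp
    ultimately have "at_state n lam (next_state n s b) (u @ emitted s b) (steps 5 c1) \<and> rnd (steps 5 c1) = stl (rnd c)"
      using c True Size by (auto simp: c1 base_def written_def)
    then show ?thesis unfolding c1_def steps_add by (intro exI[of _ 8]) simp
  next
    case False
    have d: "Suc d < n" using nxt[of "Suc d"] False Size by simp
    have "steps 12 c1 = c1\<lparr>pc := 16,
     reg := (reg c1)(5 := reg c1 5 - reg c1 4, 3 := reg c1 3 + reg c1 2,
       4 := reg c1 4 * reg c1 1 * (reg c1 0 - (reg c1 3 + reg c1 2)) * (reg c1 0 + (reg c1 3 + reg c1 2) + reg c1 2)
         / (reg c1 3 + reg c1 2) / (reg c1 3 + reg c1 2 + reg c1 2),
       6 := reg c1 3 + reg c1 2 + reg c1 2)\<rparr>"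
      by (rule block_size_Suc) (simp add: c1 False)
    moreover have "(\<Sum>e=d..<n. size_weight n lam e) = size_weight n lam d + (\<Sum>e=Suc d..<n. size_weight n lam e)"
      using d by (simp add: sum.atLeast_Suc_lessThan)
    ultimately have "at_state n lam (next_state n s b) (u @ emitted s b) (steps 12 c1) \<and> rnd (steps 12 c1) = stl (rnd c)"
      using c False Size by (simp add: c1 base_def size_weight_Suc'[OF d])
    then show ?thesis unfolding c1_def steps_add by (intro exI[of _ 15]) simp
  qed
next
  case (Open p i x)
  have c: "base n lam c" "written n u c" "pc c = 36" "reg c 3 = real (i + count_list u Cut)"
    "reg c 7 = real p" "reg c 8 = real i" "reg c 9 = real x" "reg c 2 = 1"
    using st Open by (auto simp: base_def)
  have p: "p > 0" using av Open by simp
  define c1 where "c1 = steps 10 c"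
  obtain v w where c1: "c1 = c\<lparr>pc := if b then 62 else 46,
     reg := (reg c)(11 := shd (rnd c), 12 := v, 13 := w), rnd := stl (rnd c)\<rparr>"
    unfolding c1_def block_open[OF c(3)] using b c Open by simp
  show ?thesis
  proof (cases b)
    case True
    have x: "x > 0" using av Open True by simp
    have "steps 6 c1 = c1\<lparr>pc := 36,
     reg := (reg c1)(9 := reg c1 9 - reg c1 2, 10 := real (2 * n + length u) + reg c1 2, 7 := reg c1 7 + reg c1 2),
     mem := (mem c1)(2 * n + length u := reg c1 2)\<rparr>"
      by (rule block_pop) (use c True in \<open>simp_all add: c1 written_def\<close>)
    moreover from this have "written n (u @ [Pop]) (steps 6 c1)"
      using c(8) by (intro written_snoc[OF c(2)]) (simp_all add: c1)
    ultimately have "at_state n lam (next_state n s b) (u @ emitted s b) (steps 6 c1) \<and> rnd (steps 6 c1) = stl (rnd c)"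
      using c True Open x by (simp add: c1 base_def of_nat_diff)
    then show ?thesis unfolding c1_def steps_add by (intro exI[of _ 16]) simp
  next
    case False
    then have "at_state n lam (next_state n s b) (u @ emitted s b) c1 \<and> rnd c1 = stl (rnd c)"
      using c Open p by (simp add: c1 base_def written_def)
    then show ?thesis unfolding c1_def by (intro exI[of _ 10]) simp
  qed
next
  case (Pend p i x)
  have p: "p > 0" using av Pend by simp
  have c: "base n lam c" "written n u c" "pc c = 46" "reg c 3 = real (i + count_list u Cut)"
    "reg c 7 = real p" "reg c 8 = real i" "reg c 9 = real x" "reg c 2 = 1" "reg c 20 = 0"
    using st Pend p by (auto simp: base_def)
  define c1 where "c1 = steps 11 c"
  obtain v w where c1: "c1 = c\<lparr>pc := if b then 65 else 57,
     reg := (reg c)(11 := shd (rnd c), 13 := v, 12 := w), rnd := stl (rnd c)\<rparr>"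
    unfolding c1_def block_pend[OF c(3)] using b c Pend by simp
  show ?thesis
  proof (cases b)
    case True
    have i: "i > 0" using av Pend True by simp
    have "steps 6 c1 = c1\<lparr>pc := 36,
     reg := (reg c1)(12 := 2, 8 := reg c1 8 - reg c1 2, 10 := real (2 * n + length u) + reg c1 2, 7 := reg c1 7 + reg c1 2),
     mem := (mem c1)(2 * n + length u := 2)\<rparr>"
      by (rule block_cut) (use c True in \<open>simp_all add: c1 written_def\<close>)
    moreover from this have "written n (u @ [Cut]) (steps 6 c1)"
      using c(8) by (intro written_snoc[OF c(2)]) (simp_all add: c1)
    ultimately have "at_state n lam (next_state n s b) (u @ emitted s b) (steps 6 c1) \<and> rnd (steps 6 c1) = stl (rnd c)"
      using c True Pend i by (simp add: c1 base_def of_nat_diff)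
    then show ?thesis unfolding c1_def steps_add by (intro exI[of _ 17]) simp
  next
    case False
    have "steps 4 c1 = c1\<lparr>
     pc := if reg c1 20 < reg c1 7 - reg c1 2 then 46 else 61,
     reg := (reg c1)(10 := real (2 * n + length u) + reg c1 2, 7 := reg c1 7 - reg c1 2),
     mem := (mem c1)(2 * n + length u := reg c1 20)\<rparr>"
      by (rule block_push) (use c False in \<open>simp_all add: c1 written_def\<close>)
    moreover from this have "written n (u @ [Push]) (steps 4 c1)"
      using c(8,9) by (intro written_snoc[OF c(2)]) (simp_all add: c1)
    ultimately have "at_state n lam (next_state n s b) (u @ emitted s b) (steps 4 c1) \<and> rnd (steps 4 c1) = stl (rnd c)"
      using c False Pend p by (auto simp: c1 base_def of_nat_diff)
    then show ?thesis unfolding c1_def steps_add by (intro exI[of _ 15]) simp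
  qed
qed

lemma follow_decisions:
  assumes "follows n lam s bs (rnd c)" "at_state n lam s u c"
  shows "\<exists>k\<le>20 * length bs. at_state n lam (Pend 0 0 0) (u @ letters n s bs) (steps k c)"
  using assms
proof (induction bs arbitrary: s u c)
  case Nil
  then show ?case by (auto simp: steps_0)
next
  case (Cons b bs)
  let ?s = "next_state n s b"
  have *: "available n s b" "b \<longleftrightarrow> shd (rnd c) < prob_true n lam s" "follows n lam ?s bs (stl (rnd c))"
    using Cons.prems by auto
  have "d < n" if "?s = Size d" for d
    using *(3) that by (cases bs) auto
  then obtain k where k: "k \<le> 20" "at_state n lam ?s (u @ emitted s b) (steps k c)" "rnd (steps k c) = stl (rnd c)"
    using decision[OF Cons.prems(2) *(1,2)] by blast
  obtain j where "j \<le> 20 * length bs"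
    "at_state n lam (Pend 0 0 0) ((u @ emitted s b) @ letters n ?s bs) (steps j (steps k c))"
    using Cons.IH[of ?s "steps k c"] *(3) k by metis
  then show ?case using k(1) by (intro exI[of _ "k + j"]) (simp add: steps_add)
qed

lemma sum_weights:
  assumes "d < n" "pc c = 2" "reg c 0 = real n" "reg c 1 = lam" "reg c 2 = 1" "reg c 3 = real d"
    "reg c 4 = size_weight n lam d" "reg c 5 = (\<Sum>e<d. size_weight n lam e)"
    "reg c 14 = 0" "reg c 16 = 0" "reg c 20 = 0"
  shows "\<exists>k\<le>12 * (n - d). pc (steps k c) = 14 \<and> base n lam (steps k c) \<and> rnd (steps k c) = rnd c \<and>
    reg (steps k c) 5 = (\<Sum>e<n. size_weight n lam e)"
  using assms
proof (induction "n - d" arbitrary: d c)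
  case (Suc m)
  note step = block_sum[OF Suc.prems(2)]

  show ?case
  proof (cases "Suc d < n")
    case True
    define c1 where "c1 = steps 12 c"
    have "\<exists>k\<le>12 * (n - Suc d). pc (steps k c1) = 14 \<and> base n lam (steps k c1) \<and> rnd (steps k c1) = rnd c1 \<and>
      reg (steps k c1) 5 = (\<Sum>e<n. size_weight n lam e)"
      by (rule Suc.hyps(1))
        (use Suc.hyps(2) Suc.prems True in \<open>simp_all add: c1_def step size_weight_Suc'\<close>)
    then obtain k where "k \<le> 12 * (n - Suc d)" "pc (steps (12 + k) c) = 14" "base n lam (steps (12 + k) c)"
      "rnd (steps (12 + k) c) = rnd c" "reg (steps (12 + k) c) 5 = (\<Sum>e<n. size_weight n lam e)"
      unfolding c1_def steps_add by (auto simp: step)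
    then show ?thesis using True by (intro exI[of _ "12 + k"]) simp
  next
    case False
    then have n: "n = Suc d" using Suc.prems by simp
    show ?thesis
      by (intro exI[of _ 12]) (use Suc.prems in \<open>simp add: step base_def n\<close>)
  qed
qed simp

section \<open>The decoding phase\<close>

text \<open>\<open>tl []\<close> is harmless in HOL, but on the machine the stack pointer would
  descend into the word.\<close>

primrec safe :: "letter list \<Rightarrow> bool" where
  "safe [] \<longleftrightarrow> True"
| "safe (a # w) \<longleftrightarrow> safe w \<and> length (fst (snd (decode w))) \<ge> (case a of Push \<Rightarrow> 0 | Pop \<Rightarrow> 1 | Cut \<Rightarrow> 2)"

lemma accepts_safe: "accepts n s bs \<Longrightarrow> safe (letters n s bs)"
proof (induction bs arbitrary: s)
  case (Cons b bs)
  obtain v r e where vre: "decode (letters n (next_state n s b) bs) = (v, r, e)" by (metis prod_cases3)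
  have "represents (next_state n s b) (v, r, e)"
    using accepts_represents[of n "next_state n s b" bs] Cons.prems vre by simp
  then show ?case using Cons vre by (cases s; cases b) auto
qed simp

lemma safe_drop: "safe w \<Longrightarrow> safe (drop t w)"
proof (induction t arbitrary: w)
  case (Suc t)
  then show ?case by (cases w) auto
qed simp

lemma length_chords_decode: "length (snd (snd (decode w))) = count_list w Cut"
proof (induction w)
  case (Cons a w)
  then show ?case by (cases a; cases "decode w") auto
qed simp

lemma count_list_drop_le: "count_list (drop t w) a \<le> count_list w a"
  by (metis append_take_drop_id count_list_append le_add2)

text \<open>The list has its top first while the stack grows towards higher addresses, hence
  \<open>rev r\<close>.\<close>

definition stack_at :: "nat \<Rightarrow> stack \<Rightarrow> config \<Rightarrow> bool" where
  "stack_at S t c \<longleftrightarrow> (case t of (v, r, e) \<Rightarrow>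
     reg c 14 = real v \<and> reg c 15 = real (S + length r) \<and> (\<forall>j<length r. mem c (S + j) = real (rev r ! j)) \<and>
     reg c 16 = real (2 * length e) \<and>
     (\<forall>j<length e. mem c (2 * j) = real (fst (e ! j)) \<and> mem c (2 * j + 1) = real (snd (e ! j))))"

definition decoding :: "nat \<Rightarrow> letter list \<Rightarrow> nat \<Rightarrow> config \<Rightarrow> bool" where
  "decoding n u t c \<longleftrightarrow> pc c = 73 \<and> reg c 2 = 1 \<and> reg c 20 = 0 \<and> reg c 18 = real (2 * n) \<and>
     reg c 10 = real (2 * n + t) \<and> reg c 3 = real (count_list u Cut) \<and> t \<le> length u \<and>
     (\<forall>j<t. mem c (2 * n + j) = code (u ! j)) \<and> stack_at (2 * n + length u) (decode (drop t u)) c"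

lemma decoding_step:
  assumes D: "decoding n u (Suc t) c" and safe: "safe u" and n: "count_list u Cut \<le> n"
  shows "\<exists>k\<le>13. decoding n u t (steps k c)"
proof -
  define S where "S = 2 * n + length u"
  obtain v r e where vre: "decode (drop (Suc t) u) = (v, r, e)" by (metis prod_cases3)
  have c: "pc c = 73" "reg c 2 = 1" "reg c 20 = 0" "reg c 18 = real (2 * n)" "reg c 10 = real (2 * n + Suc t)"
    "reg c 3 = real (count_list u Cut)" "t < length u" "\<And>j. j < Suc t \<Longrightarrow> mem c (2 * n + j) = code (u ! j)"
    using D unfolding decoding_def by auto
  have s: "reg c 14 = real v" "reg c 15 = real (S + length r)"
    "\<And>j. j < length r \<Longrightarrow> mem c (S + j) = real (rev r ! j)" "reg c 16 = real (2 * length e)"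
    "\<And>j. j < length e \<Longrightarrow> mem c (2 * j) = real (fst (e ! j))"
    "\<And>j. j < length e \<Longrightarrow> mem c (Suc (2 * j)) = real (snd (e ! j))"
    using D unfolding decoding_def stack_at_def S_def[symmetric] vre by auto
  have u: "drop t u = u ! t # drop (Suc t) u" using c(7) by (simp add: Cons_nth_drop_Suc)
  have dec: "decode (drop t u) = act (u ! t) (v, r, e)" unfolding u using vre by simp
  \<comment> \<open>Counting the diagonal about to be written there are at most \<open>n\<close>, so
    the output stays below cell \<open>2 * n\<close>, where the word begins.\<close>
  have len: "length e + (if u ! t = Cut then 1 else 0) \<le> n"
  proof -
    have "count_list (drop t u) Cut \<le> n" using count_list_drop_le n by (rule order_trans)
    then show ?thesis using length_chords_decode[of "drop (Suc t) u"] vre unfolding u by auto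
  qed
  have r: "length r \<ge> (case u ! t of Push \<Rightarrow> 0 | Pop \<Rightarrow> 1 | Cut \<Rightarrow> 2)"
    using safe_drop[OF safe, of t] vre unfolding u by simp
  have tS: "2 * n + t < S" "2 * n \<le> S" using c(7) by (simp_all add: S_def)
  define c1 where "c1 = steps 4 c"
  have c1: "c1 = c\<lparr>pc := if 0 < code (u ! t) then 82 else 78, reg := (reg c)(10 := real (2 * n + t), 12 := code (u ! t))\<rparr>"
    unfolding c1_def using block_load[of c "2 * n + t"] c by simp
  show ?thesis
  proof (cases "u ! t")
    case Push
    have "steps 4 c1 = c1\<lparr>pc := 73,
      reg := (reg c1)(15 := real (S + length r) + reg c1 2, 14 := reg c1 14 + reg c1 2),
      mem := (mem c1)(S + length r := reg c1 14)\<rparr>"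
      by (rule block_act_push) (use s Push in \<open>simp_all add: c1\<close>)
    then have "decoding n u t (steps 4 c1)"
      unfolding decoding_def S_def[symmetric] dec stack_at_def
      using c s Push len tS by (auto simp: c1 nth_append less_Suc_eq)
    then show ?thesis unfolding c1_def steps_add by (intro exI[of _ 8]) simp
  next
    case Pop
    then obtain a r' where r': "r = a # r'" using r by (cases r) auto
    have "steps 3 c1 = c1\<lparr>pc := 73, reg := (reg c1)(15 := reg c1 15 - reg c1 2)\<rparr>"
      by (rule block_act_pop) (use c Pop in \<open>simp_all add: c1\<close>)
    moreover have "mem c (S + j) = real (rev r' ! j)" if "j < length r'" for j
      using s(3)[of j] that by (simp add: r' nth_append)
    ultimately have "decoding n u t (steps 3 c1)"
      unfolding decoding_def S_def[symmetric] dec stack_at_def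
      using c s Pop by (simp add: c1 r')
    then show ?thesis unfolding c1_def steps_add by (intro exI[of _ 7]) simp
  next
    case Cut
    then obtain b a r' where r': "r = b # a # r'" using r by (cases r; cases "tl r") auto
    have "steps 9 c1 = c1\<lparr>pc := 73,
     reg := (reg c1)(15 := reg c1 15 - 1, 12 := mem c1 (S + length r'), 16 := real (Suc (Suc (2 * length e)))),
     mem := (mem c1)(2 * length e := mem c1 (S + length r'), Suc (2 * length e) := reg c1 14)\<rparr>"
      by (rule block_act_cut) (use c s Cut in \<open>simp_all add: c1 r'\<close>)
    moreover have "mem c (S + j) = real (rev r' ! j)" if "j < length r'" for j
      using s(3)[of j] that by (simp add: r' nth_append)
    moreover have "mem c (S + length r') = real a"
      using s(3)[of "length r'"] by (simp add: r' nth_append)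
    ultimately have "decoding n u t (steps 9 c1)"
      unfolding decoding_def S_def[symmetric] dec stack_at_def
      using c s Cut len tS by (auto simp: c1 r' nth_append less_Suc_eq)
    then show ?thesis unfolding c1_def steps_add by (intro exI[of _ 13]) simp
  qed
qed

lemma decoding_loop:
  assumes "decoding n u t c" "safe u" "count_list u Cut \<le> n"
  shows "\<exists>k\<le>13 * t. decoding n u 0 (steps k c)"
  using assms(1)
proof (induction t arbitrary: c)
  case 0
  then show ?case by (auto simp: steps_0)
next
  case (Suc t)
  obtain k where k: "k \<le> 13" "decoding n u t (steps k c)"
    using decoding_step[OF Suc.prems assms(2,3)] by blast
  obtain j where "j \<le> 13 * t" "decoding n u 0 (steps j (steps k c))"
    using Suc.IH[OF k(2)] by blast
  then show ?case using k(1) by (intro exI[of _ "k + j"]) (simp add: steps_add)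
qed

lemma decode_word:
  assumes "at_state n lam (Pend 0 0 0) u c" "safe u" "count_list u Cut \<le> n" "distinct (snd (snd (decode u)))"
  shows "\<exists>k\<le>13 * length u + 6. halted sampler (steps k c) \<and> encodes (steps k c) (set (snd (snd (decode u))))"
proof -
  have c: "base n lam c" "written n u c" "pc c = 61" "reg c 3 = real (count_list u Cut)"
    using assms(1) by auto
  have "decoding n u (length u) (steps 3 c)"
    unfolding decoding_def block_decode[OF c(3)] stack_at_def
    using c by (simp add: base_def written_def)
  then obtain k where k: "k \<le> 13 * length u" and D: "decoding n u 0 (steps k (steps 3 c))"
    using decoding_loop assms by blast
  define d where "d = steps k (steps 3 c)"
  obtain v r e where vre: "decode u = (v, r, e)" by (metis prod_cases3)
  have d: "pc d = 73" "reg d 18 = real (2 * n)" "reg d 10 = real (2 * n)" "reg d 3 = real (length e)"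
    "\<forall>j<length e. mem d (2 * j) = real (fst (e ! j)) \<and> mem d (2 * j + 1) = real (snd (e ! j))"
    using D length_chords_decode[of u] unfolding decoding_def d_def[symmetric] stack_at_def by (auto simp: vre)
  have f: "steps 3 d = d\<lparr>pc := 93, reg := (reg d)(0 := reg d 3)\<rparr>"
    by (rule block_exit) (use d in auto)
  have "halted sampler (steps 3 d)" unfolding f by (simp add: halted_def length_sampler)
  moreover have "encodes (steps 3 d) (set e)"
    unfolding encodes_def f using d assms(4) vre by (intro exI[of _ e]) simp
  ultimately show ?thesis using k
    unfolding d_def steps_add by (intro exI[of _ "3 + k + 3"]) (simp add: vre)
qed

section \<open>Complete runs, output distribution and running time\<close>

lemma length_letters: "length (letters n s bs) \<le> length bs"
proof (induction bs arbitrary: s)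
  case (Cons b bs)
  have "length (emitted s b) \<le> 1" by (cases s) auto
  then show ?case using Cons[of "next_state n s b"] by simp
qed simp

lemma sampler_correct:
  assumes n: "n > 0" and acc: "accepts n (Size 0) bs" and fol: "follows n lam (Size 0) bs \<omega>"
  shows "\<exists>k\<le>220 * n. halted sampler (run sampler n lam \<omega> k) \<and>
    encodes (run sampler n lam \<omega> k) (set (chords n (Size 0) bs))"
proof -
  define u where "u = letters n (Size 0) bs"
  obtain d cs where dcs: "bs = size_path d cs" "d < n" "accepts n (Open 2 d (n - 1 - d)) cs"
    using accepts_Size_iff[of n 0] acc by auto
  have ch: "chords n (Size 0) bs = chords n (Open 2 d (n - 1 - d)) cs"
    using letters_size_path[of n 0] dcs by (simp add: chords_def)
  have cut: "count_list u Cut \<le> n" "distinct (snd (snd (decode u)))"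
    using accepts_Open_Omega[OF dcs(2,3)] dcs(2) ch length_chords_decode[of u]
    by (simp_all add: chords_def u_def)
  define c0 where "c0 = steps 2 (init n lam \<omega>)"
  have c0: "c0 = (init n lam \<omega>)\<lparr>pc := 2, reg := (reg (init n lam \<omega>))(2 := 1, 4 := 1)\<rparr>"
    unfolding c0_def by (rule block_init) (simp add: init_def)
  obtain k1 where k1: "k1 \<le> 12 * n" "pc (steps k1 c0) = 14" "base n lam (steps k1 c0)"
    "rnd (steps k1 c0) = \<omega>" "reg (steps k1 c0) 5 = (\<Sum>e<n. size_weight n lam e)"
    using sum_weights[of 0 n c0 lam] n size_weight_0[OF n, of lam] by (auto simp: c0 init_def)
  define c1 where "c1 = steps 2 (steps k1 c0)"
  have c1: "c1 = (steps k1 c0)\<lparr>pc := 16, reg := (reg (steps k1 c0))(3 := 0, 4 := 1)\<rparr>"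
    unfolding c1_def by (rule block_reset) (rule k1)
  have "at_state n lam (Size 0) [] c1" "rnd c1 = \<omega>"
    using k1 size_weight_0[OF n, of lam] by (simp_all add: c1 base_def atLeast0LessThan)
  then obtain k2 where k2: "k2 \<le> 20 * length bs" "at_state n lam (Pend 0 0 0) u (steps k2 c1)"
    using follow_decisions[of n lam "Size 0" bs c1 "[]"] fol by (auto simp: u_def)
  obtain k3 where k3: "k3 \<le> 13 * length u + 6" "halted sampler (steps k3 (steps k2 c1))"
    "encodes (steps k3 (steps k2 c1)) (set (snd (snd (decode u))))"
    using decode_word[OF k2(2) accepts_safe[OF acc, folded u_def] cut] by blast
  have "length bs \<le> 6 * n" using accepts_length[OF acc] by simp
  moreover have "length u \<le> length bs" unfolding u_def by (rule length_letters)
  \<comment> \<open>Summing the weights takes \<open>12 * n\<close> steps, the decisions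
    \<open>20 * 6 * n\<close>, decoding \<open>13 * 6 * n + 6\<close> and the two initialisations 4;
    the constant 10 is at most \<open>10 * n\<close>.\<close>
  ultimately have "2 + k1 + 2 + k2 + k3 \<le> 220 * n" using k1 k2 k3 n by linarith
  moreover have "run sampler n lam \<omega> (2 + k1 + 2 + k2 + k3) = steps k3 (steps k2 c1)"
    unfolding c1_def c0_def steps_add by (simp add: steps_def run_def)
  ultimately show ?thesis using k3 unfolding chords_def u_def by metis
qed

lemma run_time_le: "halted P (run P n lam \<omega> k) \<Longrightarrow> run_time P n lam \<omega> \<le> of_nat k"
  unfolding run_time_def by (rule INF_lower) simp

lemma finite_Omega: "n > 0 \<Longrightarrow> finite (Omega n)"
  using bij_betw_finite[OF accepts_bij_Omega] finite_accepts by blast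

lemma prob_follows:
  assumes "lam > 0" "n > 0" "accepts n (Size 0) bs"
  shows "measure uniform_stream {\<omega>. follows n lam (Size 0) bs \<omega>} = pi_dist n lam (set (chords n (Size 0) bs))"
proof -
  obtain r where "r \<ge> 0" "emeasure uniform_stream {\<omega>. follows n lam (Size 0) bs \<omega>} = ennreal r"
    "r * total_weight n lam (Size 0) = weight n lam (Size 0) bs"
    using emeasure_follows[OF assms(1,3)] by blast
  then show ?thesis
    using total_weight_eq_Z_sum[OF assms(1,2)] Z_sum_pos[OF assms(1,2)] weight_eq_card[OF assms(3)]
    by (simp add: measure_def pi_dist_def field_simps)
qed

lemma sum_pi_dist: "lam > 0 \<Longrightarrow> n > 0 \<Longrightarrow> (\<Sum>\<sigma>\<in>Omega n. pi_dist n lam \<sigma>) = 1"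
  using Z_sum_pos[of lam n] by (simp add: pi_dist_def Z_sum_def flip: sum_divide_distrib)

text \<open>
  It is enough to bound each output probability from below by \<open>pi_dist\<close>: the events are disjoint
  and the lower bounds already add up to 1.
\<close>

lemma sampler_prob:
  assumes lam: "lam > 0" and n: "n > 0"
  shows "\<forall>\<sigma>\<in>Omega n. measure uniform_stream {\<omega>. outputs sampler n lam \<omega> \<sigma>} = pi_dist n lam \<sigma>"
    and "AE \<omega> in uniform_stream. run_time sampler n lam \<omega> \<le> of_nat (220 * n)"
proof -
  interpret prob_space uniform_stream by (rule prob_space_uniform_stream)
  \<comment> \<open>Joining the output with the time bound lets one summation also yield the almost
    sure bound on the running time.\<close>
  define E where "E \<sigma> = {\<omega>. outputs sampler n lam \<omega> \<sigma> \<and> run_time sampler n lam \<omega> \<le> of_nat (220 * n)}" for \<sigma>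
  note [measurable] = run_time_measurable
  have out [measurable]: "Measurable.pred uniform_stream (\<lambda>\<omega>. outputs sampler n lam \<omega> \<sigma>)" for \<sigma>
    using outputs_measurable by (simp add: pred_def)
  have E: "E \<sigma> \<in> events" for \<sigma>
  proof -
    have "Measurable.pred uniform_stream (\<lambda>\<omega>. outputs sampler n lam \<omega> \<sigma> \<and> run_time sampler n lam \<omega> \<le> of_nat (220 * n))"
      by measurable
    then show ?thesis by (simp add: pred_def E_def)
  qed
  have lower: "pi_dist n lam \<sigma> \<le> prob (E \<sigma>)" if "\<sigma> \<in> Omega n" for \<sigma>
  proof -
    have "\<sigma> \<in> (\<lambda>bs. set (chords n (Size 0) bs)) ` {bs. accepts n (Size 0) bs}"
      unfolding bij_betw_imp_surj_on[OF accepts_bij_Omega[OF n]] by (rule that)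
    then obtain bs where bs: "accepts n (Size 0) bs" "\<sigma> = set (chords n (Size 0) bs)"
      by (elim imageE) simp
    have sub: "{\<omega>. follows n lam (Size 0) bs \<omega>} \<subseteq> E \<sigma>"
    proof
      fix \<omega> assume "\<omega> \<in> {\<omega>. follows n lam (Size 0) bs \<omega>}"
      then obtain k where k: "k \<le> 220 * n" "halted sampler (run sampler n lam \<omega> k)" "encodes (run sampler n lam \<omega> k) \<sigma>"
        using sampler_correct[OF n bs(1)] bs(2) by blast
      have "run_time sampler n lam \<omega> \<le> of_nat k" by (rule run_time_le[OF k(2)])
      also have "\<dots> \<le> of_nat (220 * n)" using k(1) by (simp only: of_nat_le_iff)
      finally show "\<omega> \<in> E \<sigma>" using k unfolding E_def outputs_def by blast
    qed
    show ?thesis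
      using finite_measure_mono[OF sub E] prob_follows[OF lam n bs(1)] unfolding bs(2) by simp
  qed
  have disj: "disjoint_family_on E (Omega n)"
    unfolding disjoint_family_on_def E_def using outputs_unique by blast
  have sumE: "prob (\<Union>\<sigma>\<in>Omega n. E \<sigma>) = (\<Sum>\<sigma>\<in>Omega n. prob (E \<sigma>))"
    by (rule finite_measure_finite_Union) (use finite_Omega[OF n] E disj in auto)
  have "(\<Sum>\<sigma>\<in>Omega n. pi_dist n lam \<sigma>) \<le> (\<Sum>\<sigma>\<in>Omega n. prob (E \<sigma>))"
    by (rule sum_mono) (rule lower)
  then have one: "prob (\<Union>\<sigma>\<in>Omega n. E \<sigma>) = 1"
    using sumE sum_pi_dist[OF lam n] prob_le_1[of "\<Union>\<sigma>\<in>Omega n. E \<sigma>"] by linarith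
  have Un: "(\<Union>\<sigma>\<in>Omega n. E \<sigma>) \<in> events" using finite_Omega[OF n] E by blast
  show "AE \<omega> in uniform_stream. run_time sampler n lam \<omega> \<le> of_nat (220 * n)"
    using AE_prob_1[OF one] by eventually_elim (auto simp: E_def)
  let ?O = "\<lambda>\<sigma>. {\<omega>. outputs sampler n lam \<omega> \<sigma>}"
  have O: "?O \<sigma> \<in> events" for \<sigma> by (rule outputs_measurable)
  have lowerO: "pi_dist n lam \<sigma> \<le> prob (?O \<sigma>)" if "\<sigma> \<in> Omega n" for \<sigma>
    using lower[OF that] finite_measure_mono[OF _ O, of "E \<sigma>" \<sigma>] by (force simp: E_def)
  have "disjoint_family_on ?O (Omega n)"
    unfolding disjoint_family_on_def using outputs_unique by blast
  then have "(\<Sum>\<sigma>\<in>Omega n. prob (?O \<sigma>)) = prob (\<Union>\<sigma>\<in>Omega n. ?O \<sigma>)"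
    by (intro finite_measure_finite_Union[symmetric]) (use finite_Omega[OF n] O in auto)
  then have "(\<Sum>\<sigma>\<in>Omega n. prob (?O \<sigma>)) \<le> (\<Sum>\<sigma>\<in>Omega n. pi_dist n lam \<sigma>)"
    using sum_pi_dist[OF lam n] by simp
  moreover have "(\<Sum>\<sigma>\<in>Omega n. pi_dist n lam \<sigma>) \<le> (\<Sum>\<sigma>\<in>Omega n. prob (?O \<sigma>))"
    by (rule sum_mono) (rule lowerO)
  ultimately have "(\<Sum>\<sigma>\<in>Omega n. prob (?O \<sigma>) - pi_dist n lam \<sigma>) = 0"
    by (simp add: sum_subtractf)
  then show "\<forall>\<sigma>\<in>Omega n. prob (?O \<sigma>) = pi_dist n lam \<sigma>"
    using sum_nonneg_eq_0_iff[OF finite_Omega[OF n], of "\<lambda>\<sigma>. prob (?O \<sigma>) - pi_dist n lam \<sigma>"] lowerO by simp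
qed

theorem theorem1p1:
  "\<exists>C>0. \<forall>lam>0. \<exists>P. \<forall>\<^sub>F n in sequentially.
     (\<forall>\<sigma>\<in>Omega n. measure uniform_stream {\<omega>. outputs P n lam \<omega> \<sigma>} = pi_dist n lam \<sigma>) \<and>
     run_time P n lam \<in> borel_measurable uniform_stream \<and>
     (\<integral>\<^sup>+\<omega>. run_time P n lam \<omega> \<partial>uniform_stream)
       \<le> ennreal (C * ((real n * sqrt lam + 1) * ln (real n)))"
proof (intro exI[of _ 1] conjI allI impI)
  fix lam :: real assume lam: "lam > 0"
  interpret prob_space uniform_stream by (rule prob_space_uniform_stream)
  have "filterlim (\<lambda>n. ln (real n)) at_top sequentially"
    by (rule filterlim_compose[OF ln_at_top filterlim_real_sequentially])
  \<comment> \<open>The threshold for \<open>n\<close> may depend on \<open>lam\<close>, so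
    \<open>C = 1\<close> serves every \<open>lam\<close>, with the same program throughout.\<close>
  then have "eventually (\<lambda>n. 220 / sqrt lam \<le> ln (real n)) sequentially"
    by (simp add: filterlim_at_top)
  then have "\<forall>\<^sub>F n in sequentially.
     (\<forall>\<sigma>\<in>Omega n. measure uniform_stream {\<omega>. outputs sampler n lam \<omega> \<sigma>} = pi_dist n lam \<sigma>) \<and>
     run_time sampler n lam \<in> borel_measurable uniform_stream \<and>
     (\<integral>\<^sup>+\<omega>. run_time sampler n lam \<omega> \<partial>uniform_stream)
       \<le> ennreal (1 * ((real n * sqrt lam + 1) * ln (real n)))"
    using eventually_gt_at_top[of 0]
  proof eventually_elim
    case (elim n)
    have "(\<integral>\<^sup>+\<omega>. run_time sampler n lam \<omega> \<partial>uniform_stream) \<le> (\<integral>\<^sup>+\<omega>. of_nat (220 * n) \<partial>uniform_stream)"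
      by (rule nn_integral_mono_AE[OF sampler_prob(2)[OF lam elim(2)]])
    also have "\<dots> = ennreal (real (220 * n))"
      using emeasure_space_1 by (simp add: ennreal_of_nat_eq_real_of_nat)
    also have "\<dots> \<le> ennreal (1 * ((real n * sqrt lam + 1) * ln (real n)))"
    proof (rule ennreal_leI)
      have ln: "220 \<le> sqrt lam * ln (real n)" using elim(1) lam by (simp add: field_simps)
      have "real n * 220 \<le> real n * (sqrt lam * ln (real n))"
        by (rule mult_left_mono[OF ln]) simp
      moreover have "ln (real n) \<ge> 0" using elim(2) by simp
      ultimately show "real (220 * n) \<le> 1 * ((real n * sqrt lam + 1) * ln (real n))"
        by (simp add: algebra_simps)
    qed
    finally show ?case
      using sampler_prob(1)[OF lam elim(2)] run_time_measurable by blast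
  qed
  then show "\<exists>P. \<forall>\<^sub>F n in sequentially.
     (\<forall>\<sigma>\<in>Omega n. measure uniform_stream {\<omega>. outputs P n lam \<omega> \<sigma>} = pi_dist n lam \<sigma>) \<and>
     run_time P n lam \<in> borel_measurable uniform_stream \<and>
     (\<integral>\<^sup>+\<omega>. run_time P n lam \<omega> \<partial>uniform_stream)
       \<le> ennreal (1 * ((real n * sqrt lam + 1) * ln (real n)))"
    by (rule exI[of _ sampler])
qed simp

end
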